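(* Let $k=-3/2$. (1) There exists a non-trivial homomorphism of vertex superalgebras $$\overline\Phi:V^k(osp(1,2))\rightarrow V^{ns}_{cri}\otimes F\otimes\Pi^{1/2}(0)$$ such that $$e\mapsto e^{c},\qquad h\mapsto2\mu(-1)\mathbf 1,\qquad f\mapsto\left[(k+2)\omega_{1,2}-\nu(-1)^2-(k+1)\nu(-2)\right]e^{-c},$$ $$x\mapsto\sqrt2\,\Psi(-\tfrac12)e^{c/2},$$ $$y\mapsto\sqrt2\left[-\tfrac i2G^{cri}(-\tfrac32)+\Psi(-\tfrac12)\nu(-1)+\tfrac{2k+1}2\Psi(-\tfrac32)\right]e^{-c/2}.$$ (2) $T=\frac12G^{cri}(-\frac12)G^{cri}(-\frac32)\mathbf 1$ is a central element of $V^k(osp(1,2))$; that is, $T$ lies in the image of $\overline\Phi$ and is central there.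
   Context: $V^k(\mathfrak g)$ is the universal affine vertex superalgebra of level $k$. $osp(1,2)$ has even basis $e,f,h$, odd basis $x,y$, relations $[e,f]=h$, $[h,e]=2e$, $[h,f]=-2f$, $[h,x]=x$, $[e,x]=0$, $[f,x]=-y$, $[h,y]=-y$, $[e,y]=-x$, $[f,y]=0$, $\{x,x\}=2e$, $\{x,y\}=h$, $\{y,y\}=-2f$, and form with non-trivial products $(e,f)=(f,e)=1$, $(h,h)=2$, $(x,y)=-(y,x)=2$. $V^{ns}_{cri}$ is the universal vertex superalgebra freely generated by an odd field $G^{cri}(z)=\sum_{r\in\frac12+\mathbb Z}G^{cri}(r)z^{-r-3/2}$ and an even central field $T(z)=\sum_{n\in\mathbb Z}T(n)z^{-n-2}$ with $\{G^{cri}(r),G^{cri}(s)\}=2T(r+s)-(r^2-\frac14)\delta_{r+s,0}$, i.e. $[G^{cri}{}_\lambda G^{cri}]=2T-\lambda^2$. $F$ is the fermionic vertex superalgebra generated by $\Psi(z)=\sum_m\Psi(m+\frac12)z^{-m-1}$, $\{\Psi(r),\Psi(s)\}=\delta_{r+s,0}$, with $\omega_F=\frac12\Psi(-\frac32)\Psi(-\frac12)\mathbf 1$. In $V^{ns}_{cri}\otimes F$ (odd fields of the two factors anticommute), $$\omega_{1,2}=T(-2)\mathbf 1+i\,G^{cri}(-\tfrac32)\Psi(-\tfrac12)\mathbf 1+2\omega_F,$$ a Virasoro vector of central charge $-2$. Let $\langle c,c\rangle=\langle d,d\rangle=0$, $\langle c,d\rangle=2$; $M(1)$ is the Heisenberg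 vertex algebra generated by $c(z),d(z)$ with $[a(m),b(n)]=m\langle a,b\rangle\delta_{m+n,0}$; $\Pi^{1/2}(0)=M(1)\otimes\mathbb C[\mathbb Z\frac c2]$ with the usual lattice vertex operators (trivial cocycle); $\mu=\frac d2+\frac k4c$, $\nu=\frac d2-\frac k4c$ (so $c=\frac2k(\mu-\nu)$). Tensor signs are suppressed. An element is central if all modes of its field commute with all modes of all fields. *)

theory Defs
  imports Complex_Main "HOL-Library.Poly_Mapping"
begin

section \<open>Vertex superalgebras\<close>

text \<open>
  The underlying vector space is a whole type. \<open>part V False\<close> and \<open>part V True\<close> are the even
  and the odd part, and \<open>nprod V a n b\<close> is the \<open>n\<close>-th product, that is
  \<open>Y(a,z) = (\<Sum>n. a_(n) z^(-n-1))\<close> with \<open>a_(n) = nprod V a n\<close>.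
\<close>

record 'v vsa =
  smul :: "complex \<Rightarrow> 'v \<Rightarrow> 'v"
  part :: "bool \<Rightarrow> 'v set"
  vac :: 'v
  nprod :: "'v \<Rightarrow> int \<Rightarrow> 'v \<Rightarrow> 'v"

definition super_sign :: "bool \<Rightarrow> bool \<Rightarrow> complex" where
  "super_sign p q = (if p \<and> q then -1 else 1)"

text \<open>
  The last axiom is the Borcherds identity. All the sums in it have finite support by the field
  axiom, so \<^const>\<open>Sum_any\<close> is the honest sum.
\<close>

locale vertex_superalgebra =
  fixes V :: "'v::ab_group_add vsa"
  assumes vector_space: "vector_space (smul V)"
    and subspace_part: "\<And>p. module.subspace (smul V) (part V p)"
    and part_inter: "part V False \<inter> part V True = {0}"
    and part_sum: "\<And>v. \<exists>a\<in>part V False. \<exists>b\<in>part V True. v = a + b"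
    and vac_even: "vac V \<in> part V False"
    and linear_right: "\<And>a n. Vector_Spaces.linear (smul V) (smul V) (\<lambda>b. nprod V a n b)"
    and linear_left: "\<And>n b. Vector_Spaces.linear (smul V) (smul V) (\<lambda>a. nprod V a n b)"
    and nprod_part: "\<And>p q a b n. a \<in> part V p \<Longrightarrow> b \<in> part V q \<Longrightarrow> nprod V a n b \<in> part V (p \<noteq> q)"
    and field: "\<And>a b. \<exists>N. \<forall>n\<ge>N. nprod V a n b = 0"
    and vac_left: "\<And>n b. nprod V (vac V) n b = (if n = -1 then b else 0)"
    and vac_right: "\<And>a n. n \<ge> 0 \<Longrightarrow> nprod V a n (vac V) = 0"
    and creation: "\<And>a. nprod V a (-1) (vac V) = a"
    and borcherds: "\<And>p q a b c m n l. a \<in> part V p \<Longrightarrow> b \<in> part V q \<Longrightarrow>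
      Sum_any (\<lambda>j::nat. smul V (of_int m gchoose j)
          (nprod V (nprod V a (n + int j) b) (m + l - int j) c)) =
      Sum_any (\<lambda>j::nat. smul V ((-1) ^ j * (of_int n gchoose j))
          (nprod V a (m + n - int j) (nprod V b (l + int j) c)
           - smul V (super_sign p q * (-1) powi n)
               (nprod V b (n + l - int j) (nprod V a (m + int j) c))))"

definition vsa_hom :: "'v::ab_group_add vsa \<Rightarrow> 'w::ab_group_add vsa \<Rightarrow> ('v \<Rightarrow> 'w) \<Rightarrow> bool" where
  "vsa_hom V W \<phi> \<longleftrightarrow>
     Vector_Spaces.linear (smul V) (smul W) \<phi> \<and>
     (\<forall>p. \<phi> ` part V p \<subseteq> part W p) \<and>
     \<phi> (vac V) = vac W \<and>
     (\<forall>a n b. \<phi> (nprod V a n b) = nprod W (\<phi> a) n (\<phi> b))"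

text \<open>Central elements of the vertex subalgebra with underlying space \<open>S\<close>.\<close>

definition central_in :: "'v::ab_group_add vsa \<Rightarrow> 'v set \<Rightarrow> 'v \<Rightarrow> bool" where
  "central_in V S a \<longleftrightarrow> a \<in> S \<and>
     (\<forall>b\<in>S. \<forall>v\<in>S. \<forall>m n. nprod V a m (nprod V b n v) = nprod V b n (nprod V a m v))"

definition basis_family :: "(complex \<Rightarrow> 'v \<Rightarrow> 'v) \<Rightarrow> 'k set \<Rightarrow> ('k \<Rightarrow> 'v::ab_group_add) \<Rightarrow> bool" where
  "basis_family s I f \<longleftrightarrow>
     inj_on f I \<and> \<not> module.dependent s (f ` I) \<and> module.span s (f ` I) = UNIV"


section \<open>Tensor products\<close>

text \<open>
  \<open>W\<close> with the bilinear map \<open>t\<close> is the tensor product of \<open>A\<close> and \<open>B\<close>. In \<open>product\<close>, the modes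
  come from \<open>Y(a \<otimes> b, z) = Y(a,z) \<otimes> Y(b,z)\<close> and the sign from moving \<open>b\<close> past \<open>a'\<close>, so that odd
  fields of the two factors anticommute.
\<close>

locale vsa_tensor =
  A: vertex_superalgebra A + B: vertex_superalgebra B + W: vertex_superalgebra W
  for A :: "'a::ab_group_add vsa" and B :: "'b::ab_group_add vsa" and W :: "'w::ab_group_add vsa" +
  fixes t :: "'a \<Rightarrow> 'b \<Rightarrow> 'w"
  assumes bilinear_left: "\<And>b. Vector_Spaces.linear (smul A) (smul W) (\<lambda>a. t a b)"
    and bilinear_right: "\<And>a. Vector_Spaces.linear (smul B) (smul W) (\<lambda>b. t a b)"
    and basis: "\<And>X Y. basis_family (smul A) X (\<lambda>x. x) \<Longrightarrow> basis_family (smul B) Y (\<lambda>y. y) \<Longrightarrow>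
      basis_family (smul W) (X \<times> Y) (\<lambda>(x, y). t x y)"
    and tensor_vac: "t (vac A) (vac B) = vac W"
    and tensor_part: "\<And>p q a b. a \<in> part A p \<Longrightarrow> b \<in> part B q \<Longrightarrow> t a b \<in> part W (p \<noteq> q)"
    and product: "\<And>p q a b a' b' n. b \<in> part B p \<Longrightarrow> a' \<in> part A q \<Longrightarrow>
      nprod W (t a b) n (t a' b') =
      Sum_any (\<lambda>j::int. smul W (super_sign p q) (t (nprod A a j a') (nprod B b (n - j - 1) b')))"


section \<open>Universal affine vertex superalgebras\<close>

text \<open>
  Let \<open>\<gg>\<close> be a Lie superalgebra with basis indexed by \<open>'i\<close>, parities \<open>p\<close>, structure constants
  \<open>[a,b] = (\<Sum>c. br a b c * c)\<close> and form \<open>B\<close>. Words in the letters \<open>(a, n)\<close> stand for products of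
  the elements \<open>a(n) = a \<otimes> t^n\<close> of the affinization, and finitely supported functions on words
  are the elements of the free algebra on these letters. The set \<open>affine_rel p br B k\<close> is the sum
  of the two-sided ideal of the relations
  \<open>[a(m), b(n)] = [a,b](m+n) + m B(a,b) k \<delta>_(m+n,0)\<close> and of the left ideal generated by the
  \<open>a(n)\<close> with \<open>n \<ge> 0\<close>. The quotient of the free algebra by \<open>affine_rel p br B k\<close> is thus the
  induced module \<open>U(\<gg>^) \<otimes>_(U(\<gg>[t] + \<complex>K)) \<complex>_k\<close>.
\<close>

type_synonym 'i word_space = "('i \<times> int) list \<Rightarrow>\<^sub>0 complex"

inductive_set affine_rel ::
    "('i::finite \<Rightarrow> bool) \<Rightarrow> ('i \<Rightarrow> 'i \<Rightarrow> 'i \<Rightarrow> complex) \<Rightarrow> ('i \<Rightarrow> 'i \<Rightarrow> complex) \<Rightarrow> complex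
     \<Rightarrow> 'i word_space set"
  for p br B k where
    zero: "0 \<in> affine_rel p br B k"
  | add: "P \<in> affine_rel p br B k \<Longrightarrow> Q \<in> affine_rel p br B k \<Longrightarrow> P + Q \<in> affine_rel p br B k"
  | commutator:
      "Poly_Mapping.single (u @ [(a, m), (b, n)] @ w) z
       - Poly_Mapping.single (u @ [(b, n), (a, m)] @ w) (z * super_sign (p a) (p b))
       - (\<Sum>c\<in>UNIV. Poly_Mapping.single (u @ [(c, m + n)] @ w) (z * br a b c))
       - Poly_Mapping.single (u @ w) (if m + n = 0 then z * of_int m * B a b * k else 0)
       \<in> affine_rel p br B k"
  | annihilation: "n \<ge> 0 \<Longrightarrow> Poly_Mapping.single (u @ [(a, n)]) z \<in> affine_rel p br B k"

definition mode_word :: "'v vsa \<Rightarrow> ('i \<Rightarrow> 'v) \<Rightarrow> ('i \<times> int) list \<Rightarrow> 'v \<Rightarrow> 'v" where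
  "mode_word V g w v = foldr (\<lambda>(i, n). nprod V (g i) n) w v"

definition word_eval :: "'v::ab_group_add vsa \<Rightarrow> ('i \<Rightarrow> 'v) \<Rightarrow> 'i word_space \<Rightarrow> 'v" where
  "word_eval V g P =
     (\<Sum>w\<in>Poly_Mapping.keys P. smul V (Poly_Mapping.lookup P w) (mode_word V g w (vac V)))"

text \<open>
  \<open>V\<close> is the universal affine vertex superalgebra of level \<open>k\<close>, with \<open>J a\<close> the state
  \<open>a(-1)1\<close>: evaluating words on the vacuum identifies \<open>V\<close> with the induced module.
\<close>

locale universal_affine = vertex_superalgebra V
  for V :: "'v::ab_group_add vsa" +
  fixes p :: "'i::finite \<Rightarrow> bool" and br :: "'i \<Rightarrow> 'i \<Rightarrow> 'i \<Rightarrow> complex" and B :: "'i \<Rightarrow> 'i \<Rightarrow> complex"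
    and k :: complex and J :: "'i \<Rightarrow> 'v"
  assumes J_part: "\<And>a. J a \<in> part V (p a)"
    and surj_word_eval: "surj (word_eval V J)"
    and kernel_word_eval: "\<And>P. word_eval V J P = 0 \<longleftrightarrow> P \<in> affine_rel p br B k"

datatype osp = osp_e | osp_f | osp_h | osp_x | osp_y

instance osp :: finite
proof
  have "(UNIV :: osp set) \<subseteq> {osp_e, osp_f, osp_h, osp_x, osp_y}"
    using osp.exhaust by blast
  then show "finite (UNIV :: osp set)"
    using finite_subset by blast
qed

fun osp_odd :: "osp \<Rightarrow> bool" where
  "osp_odd osp_x = True"
| "osp_odd osp_y = True"
| "osp_odd _ = False"

definition osp_vec :: "complex \<Rightarrow> osp \<Rightarrow> osp \<Rightarrow> complex" where
  "osp_vec z a = (\<lambda>_. 0)(a := z)"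

fun osp_bracket :: "osp \<Rightarrow> osp \<Rightarrow> osp \<Rightarrow> complex" where
  "osp_bracket osp_e osp_f = osp_vec 1 osp_h"
| "osp_bracket osp_f osp_e = osp_vec (-1) osp_h"
| "osp_bracket osp_h osp_e = osp_vec 2 osp_e"
| "osp_bracket osp_e osp_h = osp_vec (-2) osp_e"
| "osp_bracket osp_h osp_f = osp_vec (-2) osp_f"
| "osp_bracket osp_f osp_h = osp_vec 2 osp_f"
| "osp_bracket osp_h osp_x = osp_vec 1 osp_x"
| "osp_bracket osp_x osp_h = osp_vec (-1) osp_x"
| "osp_bracket osp_f osp_x = osp_vec (-1) osp_y"
| "osp_bracket osp_x osp_f = osp_vec 1 osp_y"
| "osp_bracket osp_h osp_y = osp_vec (-1) osp_y"
| "osp_bracket osp_y osp_h = osp_vec 1 osp_y"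
| "osp_bracket osp_e osp_y = osp_vec (-1) osp_x"
| "osp_bracket osp_y osp_e = osp_vec 1 osp_x"
| "osp_bracket osp_x osp_x = osp_vec 2 osp_e"
| "osp_bracket osp_x osp_y = osp_vec 1 osp_h"
| "osp_bracket osp_y osp_x = osp_vec 1 osp_h"
| "osp_bracket osp_y osp_y = osp_vec (-2) osp_f"
| "osp_bracket _ _ = (\<lambda>_. 0)"

fun osp_form :: "osp \<Rightarrow> osp \<Rightarrow> complex" where
  "osp_form osp_e osp_f = 1"
| "osp_form osp_f osp_e = 1"
| "osp_form osp_h osp_h = 2"
| "osp_form osp_x osp_y = 2"
| "osp_form osp_y osp_x = -2"
| "osp_form _ _ = 0"


section \<open>Freely generated vertex superalgebras\<close>

text \<open>
  The list \<open>[(i1,n1), (i2,n2), \<dots>]\<close> encodes the monomial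
  \<open>g_i1_(-n1-1) g_i2_(-n2-1) \<dots>\<close> in the creation modes of the fields \<open>g_i\<close>. It is ordered if the
  indices increase weakly, the modes of each field decrease weakly, and no mode of an odd field
  is repeated.
\<close>

definition pbw_ordered :: "('i::linorder \<Rightarrow> bool) \<Rightarrow> ('i \<times> nat) list \<Rightarrow> bool" where
  "pbw_ordered odd_gen w \<longleftrightarrow>
     sorted_wrt (\<lambda>(i, m) (j, n). i < j \<or> i = j \<and> (n < m \<or> n = m \<and> \<not> odd_gen i)) w"

definition pbw_monomial :: "'v vsa \<Rightarrow> ('i \<Rightarrow> 'v) \<Rightarrow> ('i \<times> nat) list \<Rightarrow> 'v \<Rightarrow> 'v" where
  "pbw_monomial V g w v = mode_word V g (map (\<lambda>(i, n). (i, - int n - 1)) w) v"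

definition freely_generated_over ::
    "'v::ab_group_add vsa \<Rightarrow> ('i::linorder \<Rightarrow> bool) \<Rightarrow> ('i \<Rightarrow> 'v) \<Rightarrow> ('j \<Rightarrow> 'v) \<Rightarrow> bool" where
  "freely_generated_over V odd_gen g \<Omega> \<longleftrightarrow>
     basis_family (smul V) ({w. pbw_ordered odd_gen w} \<times> UNIV)
       (\<lambda>(w, j). pbw_monomial V g w (\<Omega> j))"

definition freely_generated ::
    "'v::ab_group_add vsa \<Rightarrow> ('i::linorder \<Rightarrow> bool) \<Rightarrow> ('i \<Rightarrow> 'v) \<Rightarrow> bool" where
  "freely_generated V odd_gen g \<longleftrightarrow> freely_generated_over V odd_gen g (\<lambda>_::unit. vac V)"

text \<open>
  For \<open>V^ns_cri\<close> one has \<open>G(r) = G_(r+1/2)\<close> and \<open>T(n) = T_(n+1)\<close>. Hence, with \<open>r = m - 1/2\<close> and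
  \<open>s = n - 1/2\<close>, \<open>T(r+s) = T_(m+n)\<close> and \<open>r^2 - 1/4 = m (m - 1)\<close>.
\<close>

locale ns_cri = vertex_superalgebra V
  for V :: "'v::ab_group_add vsa" +
  fixes G T :: 'v
  assumes G_odd: "G \<in> part V True"
    and T_even: "T \<in> part V False"
    and T_central: "central_in V UNIV T"
    and G_anticommutator: "\<And>m n v.
      nprod V G m (nprod V G n v) + nprod V G n (nprod V G m v) =
      smul V 2 (nprod V T (m + n) v) - (if m + n = 1 then smul V (of_int (m * (m - 1))) v else 0)"
    and free: "freely_generated V (\<lambda>i::bool. i) (\<lambda>i. if i then G else T)"

text \<open>Here \<open>\<Psi>(m + 1/2) = \<Psi>_(m)\<close>.\<close>

locale fermion = vertex_superalgebra V
  for V :: "'v::ab_group_add vsa" +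
  fixes Psi :: 'v
  assumes Psi_odd: "Psi \<in> part V True"
    and Psi_anticommutator: "\<And>m n v.
      nprod V Psi m (nprod V Psi n v) + nprod V Psi n (nprod V Psi m v) =
      (if m + n = -1 then v else 0)"
    and free: "freely_generated V (\<lambda>_::unit. True) (\<lambda>_. Psi)"


section \<open>The half-lattice vertex algebra\<close>

text \<open>
  If the operators \<open>h 1, h 2, \<dots>\<close> commute, then \<open>exp_coeff V h l\<close> is the coefficient of \<open>z^l\<close> in
  \<open>S(z) = exp (\<Sum>n\<ge>1. h n z^n / n)\<close>; the recursion compares coefficients in
  \<open>z S'(z) = (\<Sum>n\<ge>1. h n z^n) S(z)\<close>.
\<close>

fun exp_coeff :: "'v::ab_group_add vsa \<Rightarrow> (nat \<Rightarrow> 'v \<Rightarrow> 'v) \<Rightarrow> nat \<Rightarrow> 'v \<Rightarrow> 'v" where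
  "exp_coeff V h 0 v = v"
| "exp_coeff V h (Suc l) v =
     smul V (1 / of_nat (Suc l)) (\<Sum>i\<le>l. h (Suc i) (exp_coeff V h (l - i) v))"

text \<open>
  \<open>E m\<close> stands for \<open>e^(m c/2)\<close>. As a space, the algebra is \<open>M(1) \<otimes> \<complex>[\<int> c/2]\<close>: the monomials in
  \<open>c(-n), d(-n)\<close>, \<open>n \<ge> 1\<close>, applied to the \<open>E m\<close> form a basis, and \<open>E m\<close> is a highest weight
  vector for \<open>c\<close>, \<open>d\<close> on which \<open>c(0), d(0)\<close> act by \<open>\<langle>c, m c/2\<rangle> = 0\<close> and \<open>\<langle>d, m c/2\<rangle> = m\<close>.
  The axiom \<open>vertex_operator\<close> is the usual formula, with \<open>\<gamma> = m c/2\<close>,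
  \<open>Y(e^\<gamma>, z) = exp (\<Sum>n\<ge>1. \<gamma>(-n) z^n / n) exp (- \<Sum>n\<ge>1. \<gamma>(n) z^(-n) / n) e_\<gamma> z^\<gamma>(0)\<close>,
  read off at \<open>z^(-n-1)\<close>. The shift \<open>e_\<gamma>\<close> sends \<open>w (E j)\<close> to \<open>w (E (m + j))\<close> for each monomial
  \<open>w\<close> in the creation modes, and \<open>z^\<gamma>(0)\<close> is the identity because \<open>\<gamma>(0) = 0\<close>.
\<close>

locale half_lattice = vertex_superalgebra V
  for V :: "'v::ab_group_add vsa" +
  fixes c d :: 'v and E :: "int \<Rightarrow> 'v"
  assumes purely_even: "part V False = UNIV" "part V True = {0}"
    and E_0: "E 0 = vac V"
    and comm_cc: "\<And>m n v. nprod V c m (nprod V c n v) = nprod V c n (nprod V c m v)"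
    and comm_dd: "\<And>m n v. nprod V d m (nprod V d n v) = nprod V d n (nprod V d m v)"
    and comm_cd: "\<And>m n v. nprod V c m (nprod V d n v) - nprod V d n (nprod V c m v) =
      (if m + n = 0 then smul V (2 * of_int m) v else 0)"
    and c_E: "\<And>n m. n \<ge> 0 \<Longrightarrow> nprod V c n (E m) = 0"
    and d_E: "\<And>n m. n \<ge> 0 \<Longrightarrow> nprod V d n (E m) = (if n = 0 then smul V (of_int m) (E m) else 0)"
    and fock: "freely_generated_over V (\<lambda>_::bool. False) (\<lambda>i. if i then d else c) E"
    and vertex_operator: "\<And>m n w j. nprod V (E m) n
        (pbw_monomial V (\<lambda>i::bool. if i then d else c) w (E j)) =
      Sum_any (\<lambda>l::nat. if int l + n + 1 \<ge> 0 then
        exp_coeff V (\<lambda>i v. smul V (of_int m / 2) (nprod V c (- int i) v)) l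
          (exp_coeff V (\<lambda>i v. smul V (- of_int m / 2) (nprod V c (int i) v)) (nat (int l + n + 1))
            (pbw_monomial V (\<lambda>i::bool. if i then d else c) w (E (m + j))))
        else 0)"

definition mu :: "'v::ab_group_add vsa \<Rightarrow> complex \<Rightarrow> 'v \<Rightarrow> 'v \<Rightarrow> 'v" where
  "mu V k c d = smul V (1 / 2) d + smul V (k / 4) c"

definition nu :: "'v::ab_group_add vsa \<Rightarrow> complex \<Rightarrow> 'v \<Rightarrow> 'v \<Rightarrow> 'v" where
  "nu V k c d = smul V (1 / 2) d - smul V (k / 4) c"


section \<open>The conformal vectors\<close>

definition omega_F :: "'b::ab_group_add vsa \<Rightarrow> 'b \<Rightarrow> 'b" where
  "omega_F F Psi = smul F (1 / 2) (nprod F Psi (-2) (nprod F Psi (-1) (vac F)))"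

text \<open>\<open>\<omega>_(1,2)\<close> in the tensor product \<open>CF\<close> of \<open>C = V^ns_cri\<close> and \<open>F\<close>.\<close>

definition omega12 ::
    "'a::ab_group_add vsa \<Rightarrow> 'b::ab_group_add vsa \<Rightarrow> 'ab::ab_group_add vsa \<Rightarrow> ('a \<Rightarrow> 'b \<Rightarrow> 'ab)
     \<Rightarrow> 'a \<Rightarrow> 'a \<Rightarrow> 'b \<Rightarrow> 'ab" where
  "omega12 C F CF t G T Psi =
     t (nprod C T (-1) (vac C)) (vac F)
     + smul CF \<i> (t (nprod C G (-1) (vac C)) (nprod F Psi (-1) (vac F)))
     + smul CF 2 (t (vac C) (omega_F F Psi))"

end

theory Submission
  imports Defs
begin

text \<open>
  By the Borcherds identity, mode commutators only depend on the \<open>n\<close>-th products with \<open>n \<ge> 0\<close>, and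
  a map from the generators extends to the universal affine algebra as soon as these products are
  those of the affine currents. In \<open>V^ns_cri \<otimes> F \<otimes> \<Pi>^(1/2)(0)\<close> all products are computed by normal
  ordering of the modes of the free fields. Only the products among \<open>x\<close> and \<open>y\<close>, those of \<open>h\<close> with \<open>x\<close> and
  \<open>y\<close>, \<open>e_n x = 0\<close> and \<open>y_1 f = 0\<close> have to be computed: since \<open>2 e = x_0 x\<close>, \<open>h = x_0 y\<close> and \<open>-2 f = y_0 y\<close>, the rest
  follows from the Jacobi identity.

  The central element comes from the Sugawara vector: at the critical level
  \<open>2 e_(-1) f - x_(-1) y + h_(-1) h / 2 - h_(-2) 1 / 2\<close> is mapped to \<open>T\<close>. If \<open>e\<close> were mapped to a multiple
  of the vacuum, then \<open>2 e = h_0 e = 0\<close>, hence \<open>h = e_0 f = 0\<close> and \<open>2 k 1 = h_1 h = 0\<close>.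
\<close>

section \<open>Products in a vertex superalgebra\<close>

lemma Sum_any_eq_sum_lessThan:
  fixes f :: "nat \<Rightarrow> 'a::comm_monoid_add"
  assumes "\<And>j. j \<ge> N \<Longrightarrow> f j = 0"
  shows "Sum_any f = (\<Sum>j<N. f j)"
proof -
  have "{j. f j \<noteq> 0} \<subseteq> {..<N}"
    using assms by (auto simp: not_le[symmetric])
  then show ?thesis
    by (rule Sum_any.expand_superset[rotated]) simp
qed

lemma Sum_any_eq_single:
  fixes f :: "'i \<Rightarrow> 'a::comm_monoid_add"
  assumes "\<And>j. j \<noteq> i \<Longrightarrow> f j = 0"
  shows "Sum_any f = f i"
proof -
  have "{j. f j \<noteq> 0} \<subseteq> {i}"
    using assms by auto
  then have "Sum_any f = sum f {i}"
    by (rule Sum_any.expand_superset[rotated]) simp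
  then show ?thesis by simp
qed

text \<open>With the factor \<open>(-1) ^ j\<close> of the Borcherds identity, the coefficients of a
  \<open>(-1)\<close>-st product become 1; \<open>gbinomial_minus_two\<close> likewise gives
  \<open>j + 1\<close> for a \<open>(-2)\<close>-nd product.\<close>

lemma gbinomial_minus_one: "(- 1 :: complex) gchoose j = (-1) ^ j"
proof -
  have "(of_nat j :: complex) gchoose j = of_nat (j choose j)"
    by (simp only: binomial_gbinomial)
  then show ?thesis
    using gbinomial_minus[of "1::complex" j] by simp
qed

lemma gbinomial_minus_two: "(- 2 :: complex) gchoose j = (-1) ^ j * of_nat (Suc j)"
proof -
  have "(- 2 :: complex) gchoose j = (-1) ^ j * ((of_nat (Suc j)) gchoose j)"
    using gbinomial_minus[of "2::complex" j] by (simp add: algebra_simps)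
  also have "(of_nat (Suc j) :: complex) gchoose j = of_nat (Suc j choose j)"
    by (simp only: binomial_gbinomial)
  finally show ?thesis by simp
qed

context vertex_superalgebra
begin

sublocale vs: vector_space "smul V"
  by (rule vector_space)

abbreviation product (\<open>_ \<lbrace>_\<rbrace> _\<close> [91, 0, 90] 90)
  where "a \<lbrace>n\<rbrace> b \<equiv> nprod V a n b"

abbreviation scale (infixr \<open>\<odot>\<close> 75)
  where "z \<odot> v \<equiv> smul V z v"

abbreviation vacuum (\<open>\<one>\<close>)
  where "\<one> \<equiv> vac V"

lemma product_right [simp]:
  "a \<lbrace>n\<rbrace> (b + b') = a \<lbrace>n\<rbrace> b + a \<lbrace>n\<rbrace> b'"
  "a \<lbrace>n\<rbrace> (z \<odot> b) = z \<odot> a \<lbrace>n\<rbrace> b"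
  "a \<lbrace>n\<rbrace> 0 = 0"
  "a \<lbrace>n\<rbrace> (- b) = - a \<lbrace>n\<rbrace> b"
  "a \<lbrace>n\<rbrace> (b - b') = a \<lbrace>n\<rbrace> b - a \<lbrace>n\<rbrace> b'"
  "a \<lbrace>n\<rbrace> (sum f I) = (\<Sum>i\<in>I. a \<lbrace>n\<rbrace> f i)"
proof -
  interpret l: Vector_Spaces.linear "smul V" "smul V" "\<lambda>b. a \<lbrace>n\<rbrace> b"
    by (rule linear_right)
  show "a \<lbrace>n\<rbrace> (b + b') = a \<lbrace>n\<rbrace> b + a \<lbrace>n\<rbrace> b'" "a \<lbrace>n\<rbrace> (z \<odot> b) = z \<odot> a \<lbrace>n\<rbrace> b"
    "a \<lbrace>n\<rbrace> 0 = 0" "a \<lbrace>n\<rbrace> (- b) = - a \<lbrace>n\<rbrace> b" "a \<lbrace>n\<rbrace> (b - b') = a \<lbrace>n\<rbrace> b - a \<lbrace>n\<rbrace> b'"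
    "a \<lbrace>n\<rbrace> (sum f I) = (\<Sum>i\<in>I. a \<lbrace>n\<rbrace> f i)"
    by (simp_all only: l.add l.scale l.zero l.neg l.diff l.sum)
qed

lemma product_left [simp]:
  "(a + a') \<lbrace>n\<rbrace> b = a \<lbrace>n\<rbrace> b + a' \<lbrace>n\<rbrace> b"
  "(z \<odot> a) \<lbrace>n\<rbrace> b = z \<odot> a \<lbrace>n\<rbrace> b"
  "0 \<lbrace>n\<rbrace> b = 0"
  "(- a) \<lbrace>n\<rbrace> b = - a \<lbrace>n\<rbrace> b"
  "(a - a') \<lbrace>n\<rbrace> b = a \<lbrace>n\<rbrace> b - a' \<lbrace>n\<rbrace> b"
proof -
  interpret l: Vector_Spaces.linear "smul V" "smul V" "\<lambda>a. a \<lbrace>n\<rbrace> b"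
    by (rule linear_left)
  show "(a + a') \<lbrace>n\<rbrace> b = a \<lbrace>n\<rbrace> b + a' \<lbrace>n\<rbrace> b" "(z \<odot> a) \<lbrace>n\<rbrace> b = z \<odot> a \<lbrace>n\<rbrace> b"
    "0 \<lbrace>n\<rbrace> b = 0" "(- a) \<lbrace>n\<rbrace> b = - a \<lbrace>n\<rbrace> b" "(a - a') \<lbrace>n\<rbrace> b = a \<lbrace>n\<rbrace> b - a' \<lbrace>n\<rbrace> b"
    by (simp_all only: l.add l.scale l.zero l.neg l.diff)
qed

lemmas vacuum_simps [simp] = vac_left vac_right creation

lemma part_closed [intro, simp]:
  "0 \<in> part V p"
  "a \<in> part V p \<Longrightarrow> b \<in> part V p \<Longrightarrow> a + b \<in> part V p"
  "a \<in> part V p \<Longrightarrow> z \<odot> a \<in> part V p"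
  "a \<in> part V p \<Longrightarrow> - a \<in> part V p"
  "a \<in> part V p \<Longrightarrow> b \<in> part V p \<Longrightarrow> a - b \<in> part V p"
  "(\<And>i. i \<in> I \<Longrightarrow> f i \<in> part V p) \<Longrightarrow> sum f I \<in> part V p"
  using subspace_part[of p]
  by (simp_all add: vs.subspace_0 vs.subspace_add vs.subspace_scale vs.subspace_neg
      vs.subspace_diff vs.subspace_sum)

text \<open>Sign rules exist only for homogeneous vectors; additive claims extend from these because
  every vector is a sum of an even and an odd one.\<close>

lemma part_induct [consumes 0, case_names part add]:
  assumes "\<And>p a. a \<in> part V p \<Longrightarrow> Q a" "\<And>a b. Q a \<Longrightarrow> Q b \<Longrightarrow> Q (a + b)"
  shows "Q a"
  using part_sum[of a] assms by blast

text \<open>Turns vector identities into identities of complex numbers, which the simplifier can normalize.\<close>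

lemma eq_by_functionals:
  assumes "\<And>L. (\<And>u v. L (u + v) = L u + L v) \<Longrightarrow> (\<And>z v. L (z \<odot> v) = z * L v) \<Longrightarrow>
     (\<And>v. L (- v) = - L v) \<Longrightarrow> (\<And>u v. L (u - v) = L u - L v) \<Longrightarrow> L 0 = 0 \<Longrightarrow>
     L u = (L v :: complex)"
  shows "u = v"
proof -
  \<comment> \<open>Coordinates in a basis are functionals of the required kind, and they separate
    vectors.\<close>
  define B where "B = vs.extend_basis {}"
  have B: "vs.independent B" "vs.span B = UNIV"
    unfolding B_def by (simp_all add: vs.independent_extend_basis vs.span_extend_basis vs.independent_empty)
  have "vs.representation B u = vs.representation B v"
  proof
    fix b
    show "vs.representation B u b = vs.representation B v b"
      by (rule assms) (simp_all add: vs.representation_add vs.representation_scale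
          vs.representation_neg vs.representation_diff vs.representation_zero B)
  qed
  then have "vs.representation B (u - v) = (\<lambda>_. 0)"
    by (simp add: vs.representation_diff B)
  then have "(\<Sum>b | vs.representation B (u - v) b \<noteq> 0. vs.representation B (u - v) b \<odot> b) = 0"
    by simp
  then show ?thesis
    using vs.sum_nonzero_representation_eq[of B "u - v"] B by simp
qed

section \<open>Special cases of the Borcherds identity\<close>

text \<open>This is the case \<open>n = 0\<close>, where \<open>0 gchoose j\<close> leaves only
  \<open>j = 0\<close> on the right-hand side; \<open>N\<close> bounds the order of the
  pole.\<close>

lemma commutator_formula:
  assumes a: "a \<in> part V p" and b: "b \<in> part V q" and N: "\<And>j. j \<ge> N \<Longrightarrow> a \<lbrace>int j\<rbrace> b = 0"
  shows "a \<lbrace>m\<rbrace> (b \<lbrace>l\<rbrace> v) = super_sign p q \<odot> b \<lbrace>l\<rbrace> (a \<lbrace>m\<rbrace> v)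
    + (\<Sum>j<N. (of_int m gchoose j) \<odot> (a \<lbrace>int j\<rbrace> b) \<lbrace>m + l - int j\<rbrace> v)"
proof -
  let ?f = "\<lambda>j::nat. ((-1) ^ j * (of_int 0 gchoose j)) \<odot>
          (a \<lbrace>m + 0 - int j\<rbrace> (b \<lbrace>l + int j\<rbrace> v)
           - (super_sign p q * (-1) powi 0) \<odot> b \<lbrace>0 + l - int j\<rbrace> (a \<lbrace>m + int j\<rbrace> v))"
  have "?f j = 0" if "j \<noteq> 0" for j
    using that by (cases j) simp_all
  then have "Sum_any ?f = ?f 0"
    by (rule Sum_any_eq_single)
  moreover have "Sum_any (\<lambda>j::nat. (of_int m gchoose j) \<odot> (a \<lbrace>0 + int j\<rbrace> b) \<lbrace>m + l - int j\<rbrace> v)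
     = (\<Sum>j<N. (of_int m gchoose j) \<odot> (a \<lbrace>int j\<rbrace> b) \<lbrace>m + l - int j\<rbrace> v)"
    by (subst Sum_any_eq_sum_lessThan[where N = N]) (simp_all add: N)
  ultimately show ?thesis
    using borcherds[OF a b, of m 0 l v] by (simp add: algebra_simps)
qed

text \<open>Without poles the commutator vanishes. Evenness of \<open>a\<close> makes the sign 1 for
  both parities of \<open>b\<close>, so \<open>b\<close> may be arbitrary.\<close>

lemma regular_imp_commute:
  assumes a: "a \<in> part V False" and reg: "\<And>j b. j \<ge> 0 \<Longrightarrow> a \<lbrace>j\<rbrace> b = 0"
  shows "a \<lbrace>m\<rbrace> (b \<lbrace>n\<rbrace> v) = b \<lbrace>n\<rbrace> (a \<lbrace>m\<rbrace> v)"
proof (induction b rule: part_induct)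
  case (part q b)
  show ?case
    using commutator_formula[OF a part, of 0 m n v] reg by (simp add: super_sign_def)
qed simp

text \<open>This is the case \<open>m = 0\<close>, where only \<open>j = 0\<close> survives on the
  left-hand side.\<close>

lemma iterate_formula:
  assumes a: "a \<in> part V p" and b: "b \<in> part V q"
  shows "(a \<lbrace>n\<rbrace> b) \<lbrace>l\<rbrace> v =
    Sum_any (\<lambda>j::nat. ((-1) ^ j * (of_int n gchoose j)) \<odot>
       (a \<lbrace>n - int j\<rbrace> (b \<lbrace>l + int j\<rbrace> v)
        - (super_sign p q * (-1) powi n) \<odot> b \<lbrace>n + l - int j\<rbrace> (a \<lbrace>int j\<rbrace> v)))"
proof -
  let ?f = "\<lambda>j::nat. (of_int 0 gchoose j) \<odot> (a \<lbrace>n + int j\<rbrace> b) \<lbrace>0 + l - int j\<rbrace> v"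
  have "?f j = 0" if "j \<noteq> 0" for j
    using that by (cases j) simp_all
  then have "Sum_any ?f = ?f 0"
    by (rule Sum_any_eq_single)
  then show ?thesis
    using borcherds[OF a b, of 0 n l v] by simp
qed

text \<open>\<open>N\<close> cuts the normally ordered product off where both annihilation parts
  vanish on \<open>v\<close>.\<close>

lemma iterate_minus_1:
  assumes a: "a \<in> part V p" and b: "b \<in> part V q"
    and "\<And>j. j \<ge> N \<Longrightarrow> b \<lbrace>l + int j\<rbrace> v = 0" "\<And>j. j \<ge> N \<Longrightarrow> a \<lbrace>int j\<rbrace> v = 0"
  shows "(a \<lbrace>-1\<rbrace> b) \<lbrace>l\<rbrace> v = (\<Sum>j<N. a \<lbrace>-1 - int j\<rbrace> (b \<lbrace>l + int j\<rbrace> v)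
      + super_sign p q \<odot> b \<lbrace>l - 1 - int j\<rbrace> (a \<lbrace>int j\<rbrace> v))"
  unfolding iterate_formula[OF a b]
  by (subst Sum_any_eq_sum_lessThan[where N = N])
    (simp_all add: assms gbinomial_minus_one power_mult_distrib[symmetric])

text \<open>The \<open>(-2)\<close>-nd product is the normally ordered product of the derivative of
  \<open>a\<close> with \<open>b\<close>, whence the weights \<open>j + 1\<close>.\<close>

lemma iterate_minus_2:
  assumes a: "a \<in> part V p" and b: "b \<in> part V q"
    and "\<And>j. j \<ge> N \<Longrightarrow> b \<lbrace>l + int j\<rbrace> v = 0" "\<And>j. j \<ge> N \<Longrightarrow> a \<lbrace>int j\<rbrace> v = 0"
  shows "(a \<lbrace>-2\<rbrace> b) \<lbrace>l\<rbrace> v = (\<Sum>j<N. of_nat (Suc j) \<odot> (a \<lbrace>-2 - int j\<rbrace> (b \<lbrace>l + int j\<rbrace> v)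
      - super_sign p q \<odot> b \<lbrace>l - 2 - int j\<rbrace> (a \<lbrace>int j\<rbrace> v)))"
  unfolding iterate_formula[OF a b]
  by (subst Sum_any_eq_sum_lessThan[where N = N])
    (simp_all add: assms gbinomial_minus_two power_mult_distrib[symmetric] mult.assoc[symmetric])

text \<open>Apply the commutator formula with modes \<open>-1\<close> and \<open>n\<close> to the
  vacuum: \<open>b_n 1 = 0\<close> removes one term, and \<open>a_(-1) 1 = a\<close> turns another
  into \<open>b_n a\<close>.\<close>

lemma skew_symmetry:
  assumes a: "a \<in> part V p" and b: "b \<in> part V q" and N: "\<And>j. j \<ge> N \<Longrightarrow> a \<lbrace>int j\<rbrace> b = 0"
    and n: "n \<ge> 0"
  shows "b \<lbrace>n\<rbrace> a = - super_sign p q \<odot> (\<Sum>j<N. (-1) ^ j \<odot> (a \<lbrace>int j\<rbrace> b) \<lbrace>n - 1 - int j\<rbrace> \<one>)"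
proof -
  have "super_sign p q \<odot> b \<lbrace>n\<rbrace> a = - (\<Sum>j<N. (-1) ^ j \<odot> (a \<lbrace>int j\<rbrace> b) \<lbrace>n - 1 - int j\<rbrace> \<one>)"
    using commutator_formula[OF a b N, where m = "-1" and l = n and v = \<one>] n
    by (simp add: gbinomial_minus_one add_eq_0_iff2 add.commute)
  then have "super_sign p q \<odot> super_sign p q \<odot> b \<lbrace>n\<rbrace> a
      = super_sign p q \<odot> - (\<Sum>j<N. (-1) ^ j \<odot> (a \<lbrace>int j\<rbrace> b) \<lbrace>n - 1 - int j\<rbrace> \<one>)"
    by simp
  then show ?thesis
    by (auto simp: super_sign_def split: if_splits)
qed

section \<open>Operator products of current type\<close>

text \<open>\<open>a(z)b(w) \<sim> u(w)/(z-w) + \<kappa>/(z-w)^2\<close>.\<close>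

definition current_ope :: "'v \<Rightarrow> 'v \<Rightarrow> 'v \<Rightarrow> complex \<Rightarrow> bool" where
  "current_ope a b u \<kappa> \<longleftrightarrow>
     a \<lbrace>0\<rbrace> b = u \<and> a \<lbrace>1\<rbrace> b = \<kappa> \<odot> \<one> \<and> (\<forall>j\<ge>2. a \<lbrace>j\<rbrace> b = 0)"

text \<open>Two poles leave the binomial coefficients 1 and \<open>m\<close>, so these are the
  relations of an affine Lie superalgebra.\<close>

lemma current_ope_commutator:
  assumes "current_ope a b u \<kappa>" "a \<in> part V p" "b \<in> part V q"
  shows "a \<lbrace>m\<rbrace> (b \<lbrace>n\<rbrace> v) = super_sign p q \<odot> b \<lbrace>n\<rbrace> (a \<lbrace>m\<rbrace> v) + u \<lbrace>m + n\<rbrace> v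
    + (if m + n = 0 then (of_int m * \<kappa>) \<odot> v else 0)"
  using commutator_formula[of a p b q 2 m n v] assms
  by (auto simp: current_ope_def lessThan_nat_numeral lessThan_Suc numeral_2_eq_2 algebra_simps)

text \<open>The double pole is a multiple of the vacuum, so skew-symmetry adds no derivative to the
  simple pole.\<close>

lemma current_ope_swap:
  assumes ope: "current_ope a b u \<kappa>" and a: "a \<in> part V p" and b: "b \<in> part V q"
  shows "current_ope b a (- super_sign p q \<odot> u) (super_sign p q * \<kappa>)"
proof -
  have z: "a \<lbrace>int j\<rbrace> b = 0" if "j \<ge> 2" for j
    using ope that by (auto simp: current_ope_def)
  have "b \<lbrace>n\<rbrace> a = - super_sign p q \<odot> (u \<lbrace>n - 1\<rbrace> \<one> - (\<kappa> \<odot> \<one>) \<lbrace>n - 2\<rbrace> \<one>)" if "n \<ge> 0" for n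
    using skew_symmetry[OF a b z that] ope
    by (simp add: current_ope_def numeral_2_eq_2)
  then show ?thesis
    unfolding current_ope_def by (auto simp: vs.scale_right_diff_distrib)
qed

text \<open>The central term carries the factor \<open>n\<close> and requires
  \<open>n + 0 = 0\<close>, so it drops out.\<close>

lemma product_zeroth_product:
  assumes ope: "current_ope a b u \<kappa>" and a: "a \<in> part V p" and b: "b \<in> part V q" and "n \<ge> 0"
  shows "a \<lbrace>n\<rbrace> (b \<lbrace>0\<rbrace> v) = super_sign p q \<odot> b \<lbrace>0\<rbrace> (a \<lbrace>n\<rbrace> v) + u \<lbrace>n\<rbrace> v"
  using current_ope_commutator[OF ope a b, of n 0 v] by auto

text \<open>This is the Jacobi identity for operator products. As \<open>b_0\<close> kills the
  vacuum, \<kappa>' is lost and the double pole comes from \<open>u\<close> and \<open>c\<close>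
  alone.\<close>

lemma current_ope_zeroth_product:
  assumes ab: "current_ope a b u \<kappa>" and a: "a \<in> part V p" and b: "b \<in> part V q"
    and ac: "current_ope a c u' \<kappa>'" and uc: "current_ope u c u'' \<kappa>''"
    and bu': "b \<lbrace>0\<rbrace> u' = w"
  shows "current_ope a (b \<lbrace>0\<rbrace> c) (super_sign p q \<odot> w + u'') \<kappa>''"
  using product_zeroth_product[OF ab a b] ac uc bu' unfolding current_ope_def by auto

lemma current_ope_scale:
  "current_ope a b u \<kappa> \<Longrightarrow> current_ope a (z \<odot> b) (z \<odot> u) (z * \<kappa>)"
  "current_ope a b u \<kappa> \<Longrightarrow> current_ope (z \<odot> a) b (z \<odot> u) (z * \<kappa>)"
  by (auto simp: current_ope_def)

end

section \<open>Currents of osp(1,2)\<close>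

lemma UNIV_osp: "UNIV = {osp_e, osp_f, osp_h, osp_x, osp_y}"
  using osp.exhaust by blast

context vertex_superalgebra
begin

text \<open>In the second argument \<open>h\<close>, \<open>e\<close> and \<open>f\<close> are
  written as zeroth products of \<open>x\<close> and \<open>y\<close>, so that
  \<open>current_ope_zeroth_product\<close> applies; reversed pairs come from
  \<open>current_ope_swap\<close>.\<close>

lemma osp_current_opes:
  assumes parity: "e \<in> part V False" "f \<in> part V False" "h \<in> part V False"
      "x \<in> part V True" "y \<in> part V True"
    and xx: "current_ope x x (2 \<odot> e) 0" and xy: "current_ope x y h (2 * k)"
    and yy: "current_ope y y ((- 2) \<odot> f) 0" and hx: "current_ope h x x 0"
    and hy: "current_ope h y (- y) 0" and ex: "current_ope e x 0 0"
    and y_f: "y \<lbrace>1\<rbrace> f = 0"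
    and K: "K osp_e = e" "K osp_f = f" "K osp_h = h" "K osp_x = x" "K osp_y = y"
  shows "current_ope (K a) (K b) (\<Sum>i\<in>UNIV. osp_bracket a b i \<odot> K i) (osp_form a b * k)"
proof -
  note [simp] = super_sign_def
  have z: "u \<lbrace>0\<rbrace> v = w" if "current_ope u v w \<kappa>" for u v w \<kappa>
    using that by (simp add: current_ope_def)
  have double: "v + v = 2 \<odot> v" for v
    using vs.scale_left_distrib[of 1 1 v] by simp
  have half: "current_ope u ((1 / 2) \<odot> (2 \<odot> v)) ((1 / 2) \<odot> w) (1 / 2 * \<kappa>)"
    if "current_ope u (2 \<odot> v) w \<kappa>" for u v w \<kappa>
    using current_ope_scale(1)[OF that, of "1 / 2"] .
  have mhalf: "current_ope u ((- 1 / 2) \<odot> ((- 2) \<odot> v)) ((- 1 / 2) \<odot> w) (- 1 / 2 * \<kappa>)"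
    if "current_ope u ((- 2) \<odot> v) w \<kappa>" for u v w \<kappa>
    using current_ope_scale(1)[OF that, of "- 1 / 2"] .
  have neg: "current_ope (- u) v (- w) (- \<kappa>)" "current_ope u (- v) (- w) (- \<kappa>)"
    if "current_ope u v w \<kappa>" for u v w \<kappa>
    using current_ope_scale[OF that, of "- 1"] by simp_all
  have yx: "current_ope y x h (- 2 * k)"
    using current_ope_swap[OF xy parity(4,5)] by simp
  have xh: "current_ope x h (- x) 0"
    using current_ope_swap[OF hx parity(3,4)] by simp
  have yh: "current_ope y h y 0"
    using current_ope_swap[OF hy parity(3,5)] by simp
  have xe: "current_ope x e 0 0"
    using current_ope_swap[OF ex parity(1,4)] by simp
  \<comment> \<open>For \<open>h = x_0 y\<close> the two contributions \<open>- h\<close> and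
    \<open>h\<close> to the simple pole cancel, and the level is that of \<open>xy\<close>.\<close>
  have hh: "current_ope h h 0 (2 * k)"
    using current_ope_zeroth_product[OF hx parity(3,4) hy xy] z[OF xy] by simp
  have he: "current_ope h e (2 \<odot> e) 0"
    using half[of h e "4 \<odot> e" 0] current_ope_zeroth_product[OF hx parity(3,4) hx xx] z[OF xx]
    by (simp add: vs.scale_left_distrib[symmetric])
  have hf: "current_ope h f ((- 2) \<odot> f) 0"
    using mhalf[of h f "4 \<odot> f" 0]
      current_ope_zeroth_product[OF hy parity(3,5) hy neg(1)[OF yy]] z[OF yy]
    by (simp add: vs.scale_left_distrib[symmetric])
  have zero: "current_ope 0 v 0 0" for v
    by (simp add: current_ope_def)
  have ee: "current_ope e e 0 0"
    using half[of e e 0 0] current_ope_zeroth_product[OF ex parity(1,4) ex zero] z[OF xx] by simp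
  have ye: "current_ope y e x 0"
    using half[of y e "2 \<odot> x" 0] current_ope_zeroth_product[OF yx parity(5,4) yx hx] z[OF xx] z[OF xh]
    by (simp add: double)
  have xf: "current_ope x f y 0"
    using mhalf[of x f "(- 2) \<odot> y" 0] current_ope_zeroth_product[OF xy parity(4,5) xy hy] z[OF yy] z[OF yh]
    by (simp add: double flip: minus_add_distrib)
  have ey: "current_ope e y (- x) 0"
    using current_ope_swap[OF ye parity(5,1)] by simp
  have fx: "current_ope f x (- y) 0"
    using current_ope_swap[OF xf parity(4,2)] by simp
  have ef: "current_ope e f h k"
    using mhalf[of e f "(- 2) \<odot> h" "- 2 * k"]
      current_ope_zeroth_product[OF ey parity(1,5) ey neg(1)[OF xy]] z[OF yy] z[OF yx]
    by (simp add: double flip: minus_add_distrib)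
  \<comment> \<open>Since \<open>y_0 y = -2 f\<close>, the modes of \<open>f\<close> are
    anticommutators of those of \<open>y\<close>; here the modes are 0 and \<open>n\<close>.\<close>
  have f_y: "f \<lbrace>n\<rbrace> y = (- 1 / 2) \<odot> (y \<lbrace>0\<rbrace> (y \<lbrace>n\<rbrace> y) + y \<lbrace>n\<rbrace> (y \<lbrace>0\<rbrace> y))" for n
    using arg_cong[OF current_ope_commutator[OF yy parity(5,5), of 0 n y], of "\<lambda>v. (- 1 / 2) \<odot> v"]
    by (auto simp: algebra_simps z[OF yy] split: if_splits)
  have y_y: "y \<lbrace>n\<rbrace> y = 0" if "n \<ge> 1" for n
    using yy that by (cases "n = 1") (auto simp: current_ope_def)
  have f_y_pos: "f \<lbrace>n\<rbrace> y = y \<lbrace>n\<rbrace> f" if "n \<ge> 1" for n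
    by (simp add: f_y y_y that z[OF yy])
  have f_y_2: "f \<lbrace>n\<rbrace> y = 0" if "n \<ge> 2" for n
  proof -
    \<comment> \<open>Now the modes are 1 and \<open>n - 1\<close>, both positive, where
      \<open>y_m y\<close> vanishes.\<close>
    have "(- 2) \<odot> f \<lbrace>n\<rbrace> y = 0"
      using current_ope_commutator[OF yy parity(5,5), of 1 "n - 1" y] that by (simp add: y_y)
    then show ?thesis by simp
  qed
  have yf': "current_ope y f (y \<lbrace>0\<rbrace> f) 0"
    using f_y_pos f_y_2 y_f by (simp add: current_ope_def)
  \<comment> \<open>The Jacobi identity and skew-symmetry give different multiples of \<open>y_0 f\<close> for \<open>f_0 y\<close>, so both vanish.\<close>
  have "f \<lbrace>0\<rbrace> y = 2 \<odot> y \<lbrace>0\<rbrace> f"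
    by (simp add: f_y z[OF yy] double)
  moreover have "f \<lbrace>0\<rbrace> y = - y \<lbrace>0\<rbrace> f"
    using z[OF current_ope_swap[OF yf' parity(5,2)]] by simp
  ultimately have "2 \<odot> y \<lbrace>0\<rbrace> f = - y \<lbrace>0\<rbrace> f"
    by simp
  then have "(2 + 1) \<odot> y \<lbrace>0\<rbrace> f = 0"
    by (simp only: vs.scale_left_distrib vs.scale_one add.left_inverse)
  then have yf: "current_ope y f 0 0"
    using yf' by simp
  have fy: "current_ope f y 0 0"
    using current_ope_swap[OF yf parity(5,2)] by simp
  have ff: "current_ope f f 0 0"
    using mhalf[of f f 0 0] current_ope_zeroth_product[OF fy parity(2,5) fy zero] z[OF yy] by simp
  have eh: "current_ope e h ((- 2) \<odot> e) 0" and fh: "current_ope f h (2 \<odot> f) 0"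
    and fe: "current_ope f e (- h) k"
    using current_ope_swap[OF he parity(3,1)] current_ope_swap[OF hf parity(3,2)]
      current_ope_swap[OF ef parity(1,2)] by simp_all
  note opes = ee ef eh ex ey fe ff fh fx fy he hf hh hx hy xe xf xh xx xy ye yf yh yx yy
  show ?thesis
    using opes by (cases a; cases b) (simp_all add: UNIV_osp osp_vec_def K mult.commute)
qed

end

section \<open>Calculus of the free fields\<close>

text \<open>
  The free fields of the realization at \<open>k = -3/2\<close>, with \<open>\<nu> = d/2 + 3c/8\<close> in place of \<open>d\<close>. Only the products
  \<open>E r _(-n) E s\<close> with \<open>n \<le> 3\<close> occur in the computations.
\<close>

locale free_fields = vertex_superalgebra V for V :: "'w::ab_group_add vsa" +
  fixes g \<tau> \<psi> c \<nu> :: 'w and E :: "int \<Rightarrow> 'w"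
  assumes parity: "g \<in> part V True" "\<tau> \<in> part V False" "\<psi> \<in> part V True"
      "c \<in> part V False" "\<nu> \<in> part V False" "E r \<in> part V False"
    and g_g: "j \<ge> 0 \<Longrightarrow> g \<lbrace>j\<rbrace> g = (if j = 0 then 2 \<odot> \<tau> else if j = 2 then (-2) \<odot> \<one> else 0)"
    and g_regular: "j \<ge> 0 \<Longrightarrow> g \<lbrace>j\<rbrace> \<psi> = 0" "j \<ge> 0 \<Longrightarrow> g \<lbrace>j\<rbrace> c = 0" "j \<ge> 0 \<Longrightarrow> g \<lbrace>j\<rbrace> \<nu> = 0"
      "j \<ge> 0 \<Longrightarrow> g \<lbrace>j\<rbrace> E r = 0"
    and \<tau>_regular: "j \<ge> 0 \<Longrightarrow> \<tau> \<lbrace>j\<rbrace> v = 0"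
    and \<psi>_\<psi>: "j \<ge> 0 \<Longrightarrow> \<psi> \<lbrace>j\<rbrace> \<psi> = (if j = 0 then \<one> else 0)"
    and \<psi>_regular: "j \<ge> 0 \<Longrightarrow> \<psi> \<lbrace>j\<rbrace> c = 0" "j \<ge> 0 \<Longrightarrow> \<psi> \<lbrace>j\<rbrace> \<nu> = 0" "j \<ge> 0 \<Longrightarrow> \<psi> \<lbrace>j\<rbrace> E r = 0"
    and c_c: "j \<ge> 0 \<Longrightarrow> c \<lbrace>j\<rbrace> c = 0"
    and c_\<nu>: "j \<ge> 0 \<Longrightarrow> c \<lbrace>j\<rbrace> \<nu> = (if j = 1 then \<one> else 0)"
    and \<nu>_\<nu>: "j \<ge> 0 \<Longrightarrow> \<nu> \<lbrace>j\<rbrace> \<nu> = (if j = 1 then (3 / 4) \<odot> \<one> else 0)"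
    and c_E: "j \<ge> 0 \<Longrightarrow> c \<lbrace>j\<rbrace> E r = 0"
    and \<nu>_E: "j \<ge> 0 \<Longrightarrow> \<nu> \<lbrace>j\<rbrace> E r = (if j = 0 then (of_int r / 2) \<odot> E r else 0)"
    and E_0: "E 0 = \<one>"
    and E_E: "j \<ge> 0 \<Longrightarrow> E r \<lbrace>j\<rbrace> E s = 0"
      "E r \<lbrace>-1\<rbrace> E s = E (r + s)"
      "E r \<lbrace>-2\<rbrace> E s = (of_int r / 2) \<odot> c \<lbrace>-1\<rbrace> E (r + s)"
      "E r \<lbrace>-3\<rbrace> E s = (1 / 2) \<odot> ((of_int r / 2) \<odot> c \<lbrace>-2\<rbrace> E (r + s)
         + (of_int r / 2)\<^sup>2 \<odot> c \<lbrace>-1\<rbrace> (c \<lbrace>-1\<rbrace> E (r + s)))"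
begin

section \<open>Commutators of the free modes and normal ordering\<close>

lemma regular_commute:
  assumes "a \<in> part V p" "b \<in> part V q" "\<And>j. j \<ge> 0 \<Longrightarrow> a \<lbrace>j\<rbrace> b = 0"
  shows "a \<lbrace>m\<rbrace> (b \<lbrace>n\<rbrace> v) = super_sign p q \<odot> b \<lbrace>n\<rbrace> (a \<lbrace>m\<rbrace> v)"
  using commutator_formula[of a p b q 0 m n v] assms by simp

lemma modes_commute:
  "g \<lbrace>m\<rbrace> (\<psi> \<lbrace>n\<rbrace> v) = - \<psi> \<lbrace>n\<rbrace> (g \<lbrace>m\<rbrace> v)"
  "g \<lbrace>m\<rbrace> (c \<lbrace>n\<rbrace> v) = c \<lbrace>n\<rbrace> (g \<lbrace>m\<rbrace> v)"
  "g \<lbrace>m\<rbrace> (\<nu> \<lbrace>n\<rbrace> v) = \<nu> \<lbrace>n\<rbrace> (g \<lbrace>m\<rbrace> v)"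
  "g \<lbrace>m\<rbrace> (E r \<lbrace>n\<rbrace> v) = E r \<lbrace>n\<rbrace> (g \<lbrace>m\<rbrace> v)"
  "\<psi> \<lbrace>m\<rbrace> (c \<lbrace>n\<rbrace> v) = c \<lbrace>n\<rbrace> (\<psi> \<lbrace>m\<rbrace> v)"
  "\<psi> \<lbrace>m\<rbrace> (\<nu> \<lbrace>n\<rbrace> v) = \<nu> \<lbrace>n\<rbrace> (\<psi> \<lbrace>m\<rbrace> v)"
  "\<psi> \<lbrace>m\<rbrace> (E r \<lbrace>n\<rbrace> v) = E r \<lbrace>n\<rbrace> (\<psi> \<lbrace>m\<rbrace> v)"
  "c \<lbrace>m\<rbrace> (c \<lbrace>n\<rbrace> v) = c \<lbrace>n\<rbrace> (c \<lbrace>m\<rbrace> v)"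
  "c \<lbrace>m\<rbrace> (E r \<lbrace>n\<rbrace> v) = E r \<lbrace>n\<rbrace> (c \<lbrace>m\<rbrace> v)"
  "\<tau> \<lbrace>m\<rbrace> (g \<lbrace>n\<rbrace> v) = g \<lbrace>n\<rbrace> (\<tau> \<lbrace>m\<rbrace> v)"
  "\<tau> \<lbrace>m\<rbrace> (\<psi> \<lbrace>n\<rbrace> v) = \<psi> \<lbrace>n\<rbrace> (\<tau> \<lbrace>m\<rbrace> v)"
  "\<tau> \<lbrace>m\<rbrace> (c \<lbrace>n\<rbrace> v) = c \<lbrace>n\<rbrace> (\<tau> \<lbrace>m\<rbrace> v)"
  "\<tau> \<lbrace>m\<rbrace> (\<nu> \<lbrace>n\<rbrace> v) = \<nu> \<lbrace>n\<rbrace> (\<tau> \<lbrace>m\<rbrace> v)"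
  "\<tau> \<lbrace>m\<rbrace> (E r \<lbrace>n\<rbrace> v) = E r \<lbrace>n\<rbrace> (\<tau> \<lbrace>m\<rbrace> v)"
  using regular_commute[OF parity(1) parity(3) g_regular(1), where m = m and n = n and v = v]
    regular_commute[OF parity(1) parity(4) g_regular(2), where m = m and n = n and v = v]
    regular_commute[OF parity(1) parity(5) g_regular(3), where m = m and n = n and v = v]
    regular_commute[OF parity(1) parity(6) g_regular(4), where m = m and n = n and v = v]
    regular_commute[OF parity(3) parity(4) \<psi>_regular(1), where m = m and n = n and v = v]
    regular_commute[OF parity(3) parity(5) \<psi>_regular(2), where m = m and n = n and v = v]
    regular_commute[OF parity(3) parity(6) \<psi>_regular(3), where m = m and n = n and v = v]
    regular_commute[OF parity(4) parity(4) c_c, where m = m and n = n and v = v]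
    regular_commute[OF parity(4) parity(6) c_E, where m = m and n = n and v = v]
    regular_commute[OF parity(2) parity(1) \<tau>_regular, where m = m and n = n and v = v]
    regular_commute[OF parity(2) parity(3) \<tau>_regular, where m = m and n = n and v = v]
    regular_commute[OF parity(2) parity(4) \<tau>_regular, where m = m and n = n and v = v]
    regular_commute[OF parity(2) parity(5) \<tau>_regular, where m = m and n = n and v = v]
    regular_commute[OF parity(2) parity(6) \<tau>_regular, where m = m and n = n and v = v]
  by (simp_all add: super_sign_def)

lemma g_g_modes:
  "g \<lbrace>m\<rbrace> (g \<lbrace>n\<rbrace> v) = - g \<lbrace>n\<rbrace> (g \<lbrace>m\<rbrace> v) + 2 \<odot> \<tau> \<lbrace>m + n\<rbrace> v
     - (if m + n = 1 then (of_int (m * (m - 1))) \<odot> v else 0)"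
proof -
  \<comment> \<open>The third-order pole \<open>-2\<close> contributes \<open>-2\<close> times this
    binomial coefficient.\<close>
  have "(of_int m :: complex) gchoose 2 = of_int (m * (m - 1)) / 2"
    by (simp add: gbinomial_prod_rev numeral_2_eq_2 atLeast0_lessThan_Suc)
  moreover have "g \<lbrace>m\<rbrace> (g \<lbrace>n\<rbrace> v) = - g \<lbrace>n\<rbrace> (g \<lbrace>m\<rbrace> v) + 2 \<odot> \<tau> \<lbrace>m + n\<rbrace> v
      - ((of_int m gchoose 2) * 2) \<odot> \<one> \<lbrace>m + n - 2\<rbrace> v"
    using commutator_formula[of g True g True 3 m n v] parity g_g
    by (simp add: eval_nat_numeral super_sign_def vs.scale_minus_left)
  ultimately show ?thesis
    by simp
qed

lemma \<psi>_\<psi>_modes: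
  "\<psi> \<lbrace>m\<rbrace> (\<psi> \<lbrace>n\<rbrace> v) = - \<psi> \<lbrace>n\<rbrace> (\<psi> \<lbrace>m\<rbrace> v) + (if m + n = -1 then v else 0)"
  using commutator_formula[of \<psi> True \<psi> True 1 m n v] parity \<psi>_\<psi>
  by (simp add: super_sign_def)

lemma c_\<nu>_modes:
  "c \<lbrace>m\<rbrace> (\<nu> \<lbrace>n\<rbrace> v) = \<nu> \<lbrace>n\<rbrace> (c \<lbrace>m\<rbrace> v) + (if m + n = 0 then of_int m \<odot> v else 0)"
  using commutator_formula[of c False \<nu> False 2 m n v] parity c_\<nu>
  by (simp add: super_sign_def numeral_2_eq_2 algebra_simps)

lemma \<nu>_\<nu>_modes:
  "\<nu> \<lbrace>m\<rbrace> (\<nu> \<lbrace>n\<rbrace> v) = \<nu> \<lbrace>n\<rbrace> (\<nu> \<lbrace>m\<rbrace> v) + (if m + n = 0 then (of_int m * (3 / 4)) \<odot> v else 0)"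
  using commutator_formula[of \<nu> False \<nu> False 2 m n v] parity \<nu>_\<nu>
  by (simp add: super_sign_def numeral_2_eq_2 algebra_simps)

lemma \<nu>_E_modes:
  "\<nu> \<lbrace>m\<rbrace> (E r \<lbrace>n\<rbrace> v) = E r \<lbrace>n\<rbrace> (\<nu> \<lbrace>m\<rbrace> v) + (of_int r / 2) \<odot> E r \<lbrace>m + n\<rbrace> v"
  using commutator_formula[of \<nu> False "E r" False 1 m n v] parity \<nu>_E
  by (simp add: super_sign_def)

text \<open>The sign conditions orient the commutators as rewrite rules: annihilation modes only
  move inwards past creation modes, so rewriting does not loop.\<close>

lemma move_annihilators:
  assumes "m \<ge> 0" "n < 0"
  shows "g \<lbrace>m\<rbrace> (\<psi> \<lbrace>n\<rbrace> v) = - \<psi> \<lbrace>n\<rbrace> (g \<lbrace>m\<rbrace> v)"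
    "g \<lbrace>m\<rbrace> (c \<lbrace>n\<rbrace> v) = c \<lbrace>n\<rbrace> (g \<lbrace>m\<rbrace> v)"
    "g \<lbrace>m\<rbrace> (\<nu> \<lbrace>n\<rbrace> v) = \<nu> \<lbrace>n\<rbrace> (g \<lbrace>m\<rbrace> v)"
    "g \<lbrace>m\<rbrace> (\<tau> \<lbrace>n\<rbrace> v) = \<tau> \<lbrace>n\<rbrace> (g \<lbrace>m\<rbrace> v)"
    "g \<lbrace>m\<rbrace> (g \<lbrace>n\<rbrace> v) = - g \<lbrace>n\<rbrace> (g \<lbrace>m\<rbrace> v) + 2 \<odot> \<tau> \<lbrace>m + n\<rbrace> v
       - (if m + n = 1 then (of_int (m * (m - 1))) \<odot> v else 0)"
    "\<psi> \<lbrace>m\<rbrace> (g \<lbrace>n\<rbrace> v) = - g \<lbrace>n\<rbrace> (\<psi> \<lbrace>m\<rbrace> v)"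
    "\<psi> \<lbrace>m\<rbrace> (c \<lbrace>n\<rbrace> v) = c \<lbrace>n\<rbrace> (\<psi> \<lbrace>m\<rbrace> v)"
    "\<psi> \<lbrace>m\<rbrace> (\<nu> \<lbrace>n\<rbrace> v) = \<nu> \<lbrace>n\<rbrace> (\<psi> \<lbrace>m\<rbrace> v)"
    "\<psi> \<lbrace>m\<rbrace> (\<tau> \<lbrace>n\<rbrace> v) = \<tau> \<lbrace>n\<rbrace> (\<psi> \<lbrace>m\<rbrace> v)"
    "\<psi> \<lbrace>m\<rbrace> (\<psi> \<lbrace>n\<rbrace> v) = - \<psi> \<lbrace>n\<rbrace> (\<psi> \<lbrace>m\<rbrace> v) + (if m + n = -1 then v else 0)"
    "c \<lbrace>m\<rbrace> (g \<lbrace>n\<rbrace> v) = g \<lbrace>n\<rbrace> (c \<lbrace>m\<rbrace> v)"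
    "c \<lbrace>m\<rbrace> (c \<lbrace>n\<rbrace> v) = c \<lbrace>n\<rbrace> (c \<lbrace>m\<rbrace> v)"
    "c \<lbrace>m\<rbrace> (\<psi> \<lbrace>n\<rbrace> v) = \<psi> \<lbrace>n\<rbrace> (c \<lbrace>m\<rbrace> v)"
    "c \<lbrace>m\<rbrace> (\<tau> \<lbrace>n\<rbrace> v) = \<tau> \<lbrace>n\<rbrace> (c \<lbrace>m\<rbrace> v)"
    "c \<lbrace>m\<rbrace> (\<nu> \<lbrace>n\<rbrace> v) = \<nu> \<lbrace>n\<rbrace> (c \<lbrace>m\<rbrace> v) + (if m + n = 0 then of_int m \<odot> v else 0)"
    "\<nu> \<lbrace>m\<rbrace> (g \<lbrace>n\<rbrace> v) = g \<lbrace>n\<rbrace> (\<nu> \<lbrace>m\<rbrace> v)"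
    "\<nu> \<lbrace>m\<rbrace> (\<psi> \<lbrace>n\<rbrace> v) = \<psi> \<lbrace>n\<rbrace> (\<nu> \<lbrace>m\<rbrace> v)"
    "\<nu> \<lbrace>m\<rbrace> (\<tau> \<lbrace>n\<rbrace> v) = \<tau> \<lbrace>n\<rbrace> (\<nu> \<lbrace>m\<rbrace> v)"
    "\<nu> \<lbrace>m\<rbrace> (c \<lbrace>n\<rbrace> v) = c \<lbrace>n\<rbrace> (\<nu> \<lbrace>m\<rbrace> v) + (if m + n = 0 then of_int m \<odot> v else 0)"
    "\<nu> \<lbrace>m\<rbrace> (\<nu> \<lbrace>n\<rbrace> v) = \<nu> \<lbrace>n\<rbrace> (\<nu> \<lbrace>m\<rbrace> v) + (if m + n = 0 then (of_int m * (3 / 4)) \<odot> v else 0)"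
proof -
  \<comment> \<open>Read backwards, \<open>c_\<nu>_modes\<close> has the central factor
    \<open>n\<close>, which is \<open>- m\<close> where it matters.\<close>
  have "m + n = 0 \<Longrightarrow> of_int n \<odot> v = - (of_int m \<odot> v)"
    by (simp add: eq_neg_iff_add_eq_0 vs.scale_left_distrib[symmetric] of_int_add[symmetric] del: of_int_add)
  then show "\<nu> \<lbrace>m\<rbrace> (c \<lbrace>n\<rbrace> v) = c \<lbrace>n\<rbrace> (\<nu> \<lbrace>m\<rbrace> v) + (if m + n = 0 then of_int m \<odot> v else 0)"
    using c_\<nu>_modes[of n m v] by (simp add: add.commute)
qed (use g_g_modes[of m n v] \<psi>_\<psi>_modes[of m n v] \<nu>_\<nu>_modes[of m n v]
    c_\<nu>_modes[of m n v] in \<open>simp_all add: modes_commute\<close>)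

text \<open>Modes of \<open>E r\<close> are pushed inwards whatever their index, until they meet
  some \<open>E s\<close> and \<open>E_E\<close> evaluates them.\<close>

lemma move_E:
  "E r \<lbrace>m\<rbrace> (g \<lbrace>n\<rbrace> v) = g \<lbrace>n\<rbrace> (E r \<lbrace>m\<rbrace> v)"
  "E r \<lbrace>m\<rbrace> (\<psi> \<lbrace>n\<rbrace> v) = \<psi> \<lbrace>n\<rbrace> (E r \<lbrace>m\<rbrace> v)"
  "E r \<lbrace>m\<rbrace> (\<tau> \<lbrace>n\<rbrace> v) = \<tau> \<lbrace>n\<rbrace> (E r \<lbrace>m\<rbrace> v)"
  "E r \<lbrace>m\<rbrace> (c \<lbrace>n\<rbrace> v) = c \<lbrace>n\<rbrace> (E r \<lbrace>m\<rbrace> v)"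
  "E r \<lbrace>m\<rbrace> (\<nu> \<lbrace>n\<rbrace> v) = \<nu> \<lbrace>n\<rbrace> (E r \<lbrace>m\<rbrace> v) - (of_int r / 2) \<odot> E r \<lbrace>m + n\<rbrace> v"
  by (simp_all add: modes_commute \<nu>_E_modes add.commute)

text \<open>The anticommutator of this mode with itself vanishes because \<open>2 m = -1\<close> has
  no integer solution.\<close>

lemma \<psi>_square: "\<psi> \<lbrace>m\<rbrace> (\<psi> \<lbrace>m\<rbrace> v) = 0"
proof (rule eq_by_functionals)
  fix L :: "'w \<Rightarrow> complex"
  assume L: "\<And>v. L (- v) = - L v" "L 0 = 0"
  have "\<psi> \<lbrace>m\<rbrace> (\<psi> \<lbrace>m\<rbrace> v) = - \<psi> \<lbrace>m\<rbrace> (\<psi> \<lbrace>m\<rbrace> v)"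
    using \<psi>_\<psi>_modes[of m m v] by (simp split: if_splits) presburger
  then have "L (\<psi> \<lbrace>m\<rbrace> (\<psi> \<lbrace>m\<rbrace> v)) = - L (\<psi> \<lbrace>m\<rbrace> (\<psi> \<lbrace>m\<rbrace> v))"
    using L(1) by metis
  then show "L (\<psi> \<lbrace>m\<rbrace> (\<psi> \<lbrace>m\<rbrace> v)) = L 0"
    by (simp add: L(2))
qed

text \<open>In the normal form the creation modes of \<open>g\<close>, \<psi>, \<tau>, \<nu>,
  \<open>c\<close> stand in this order from the outside in, with decreasing indices for \<psi>,
  \<nu> and \<open>c\<close>.\<close>

lemma order_creators:
  assumes "m < 0" "n < 0"
  shows "\<psi> \<lbrace>m\<rbrace> (g \<lbrace>n\<rbrace> v) = - g \<lbrace>n\<rbrace> (\<psi> \<lbrace>m\<rbrace> v)"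
    "c \<lbrace>m\<rbrace> (g \<lbrace>n\<rbrace> v) = g \<lbrace>n\<rbrace> (c \<lbrace>m\<rbrace> v)"
    "\<nu> \<lbrace>m\<rbrace> (g \<lbrace>n\<rbrace> v) = g \<lbrace>n\<rbrace> (\<nu> \<lbrace>m\<rbrace> v)"
    "\<tau> \<lbrace>m\<rbrace> (g \<lbrace>n\<rbrace> v) = g \<lbrace>n\<rbrace> (\<tau> \<lbrace>m\<rbrace> v)"
    "\<tau> \<lbrace>m\<rbrace> (\<psi> \<lbrace>n\<rbrace> v) = \<psi> \<lbrace>n\<rbrace> (\<tau> \<lbrace>m\<rbrace> v)"
    "\<nu> \<lbrace>m\<rbrace> (\<psi> \<lbrace>n\<rbrace> v) = \<psi> \<lbrace>n\<rbrace> (\<nu> \<lbrace>m\<rbrace> v)"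
    "c \<lbrace>m\<rbrace> (\<psi> \<lbrace>n\<rbrace> v) = \<psi> \<lbrace>n\<rbrace> (c \<lbrace>m\<rbrace> v)"
    "\<nu> \<lbrace>m\<rbrace> (\<tau> \<lbrace>n\<rbrace> v) = \<tau> \<lbrace>n\<rbrace> (\<nu> \<lbrace>m\<rbrace> v)"
    "c \<lbrace>m\<rbrace> (\<tau> \<lbrace>n\<rbrace> v) = \<tau> \<lbrace>n\<rbrace> (c \<lbrace>m\<rbrace> v)"
    "c \<lbrace>m\<rbrace> (\<nu> \<lbrace>n\<rbrace> v) = \<nu> \<lbrace>n\<rbrace> (c \<lbrace>m\<rbrace> v)"
    "m < n \<Longrightarrow> \<psi> \<lbrace>m\<rbrace> (\<psi> \<lbrace>n\<rbrace> v) = - \<psi> \<lbrace>n\<rbrace> (\<psi> \<lbrace>m\<rbrace> v)"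
    "m < n \<Longrightarrow> \<nu> \<lbrace>m\<rbrace> (\<nu> \<lbrace>n\<rbrace> v) = \<nu> \<lbrace>n\<rbrace> (\<nu> \<lbrace>m\<rbrace> v)"
    "m < n \<Longrightarrow> c \<lbrace>m\<rbrace> (c \<lbrace>n\<rbrace> v) = c \<lbrace>n\<rbrace> (c \<lbrace>m\<rbrace> v)"
proof -
  show "m < n \<Longrightarrow> \<psi> \<lbrace>m\<rbrace> (\<psi> \<lbrace>n\<rbrace> v) = - \<psi> \<lbrace>n\<rbrace> (\<psi> \<lbrace>m\<rbrace> v)"
    using \<psi>_\<psi>_modes[of m n v] assms by (simp split: if_splits)
next
  show "m < n \<Longrightarrow> c \<lbrace>m\<rbrace> (c \<lbrace>n\<rbrace> v) = c \<lbrace>n\<rbrace> (c \<lbrace>m\<rbrace> v)"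
    by (rule modes_commute)
next
  show "c \<lbrace>m\<rbrace> (\<nu> \<lbrace>n\<rbrace> v) = \<nu> \<lbrace>n\<rbrace> (c \<lbrace>m\<rbrace> v)" "\<nu> \<lbrace>m\<rbrace> (\<nu> \<lbrace>n\<rbrace> v) = \<nu> \<lbrace>n\<rbrace> (\<nu> \<lbrace>m\<rbrace> v)"
    using c_\<nu>_modes[of m n v] \<nu>_\<nu>_modes[of m n v] assms by simp_all
qed (simp_all add: modes_commute)

text \<open>Rewriting with \<open>wick\<close> turns mode monomials with numeral indices into normally ordered ones.\<close>

lemmas wick = move_annihilators move_E order_creators E_E
  \<psi>_square \<tau>_regular g_regular(4) \<psi>_regular(3) c_E \<nu>_E

section \<open>Images of the generators and the products with x\<close>

text \<open>\<open>x0\<close> and \<open>y0\<close> are the images of \<open>x\<close> and \<open>y\<close> divided by \<open>sqrt 2\<close>.\<close>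

definition x0 :: 'w where "x0 = \<psi> \<lbrace>-1\<rbrace> E 1"

text \<open>Naming this even vector makes the middle term of \<open>y0\<close> a product of two
  fields, to which \<open>iterate_minus_1\<close> applies.\<close>

definition w0 :: 'w where "w0 = \<nu> \<lbrace>-1\<rbrace> E (-1)"

definition y0 :: 'w where
  "y0 = (- \<i> / 2) \<odot> g \<lbrace>-1\<rbrace> E (-1) + \<psi> \<lbrace>-1\<rbrace> w0 - \<psi> \<lbrace>-2\<rbrace> E (-1)"

text \<open>This is \<open>2 \<mu> = 2 \<nu> + k c\<close>. The vacuum is written as
  \<open>E 0\<close> so that the rules for \<open>E r\<close> apply.\<close>

definition h0 :: 'w where "h0 = 2 \<odot> \<nu> \<lbrace>-1\<rbrace> E 0 - (3 / 2) \<odot> c \<lbrace>-1\<rbrace> E 0"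

text \<open>The first factor \<open>1 / 2\<close> is \<open>k + 2\<close>, the last one is
  \<open>- (k + 1)\<close>; the bracket is \<omega>_(1,2), using that \<open>2 \<omega>_F\<close> is
  the product of two modes of \<psi>.\<close>

definition f0 :: 'w where
  "f0 = (1 / 2) \<odot> (\<tau> \<lbrace>-1\<rbrace> E (-2) + \<i> \<odot> g \<lbrace>-1\<rbrace> (\<psi> \<lbrace>-1\<rbrace> E (-2)) + \<psi> \<lbrace>-2\<rbrace> (\<psi> \<lbrace>-1\<rbrace> E (-2)))
     - \<nu> \<lbrace>-1\<rbrace> (\<nu> \<lbrace>-1\<rbrace> E (-2)) + (1 / 2) \<odot> \<nu> \<lbrace>-2\<rbrace> E (-2)"

lemmas field_defs = x0_def y0_def w0_def h0_def f0_def

lemma h0_modes: "h0 \<lbrace>n\<rbrace> v = 2 \<odot> \<nu> \<lbrace>n\<rbrace> v - (3 / 2) \<odot> c \<lbrace>n\<rbrace> v"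
  by (simp add: h0_def E_0)

lemma w0_even: "w0 \<in> part V False"
  using nprod_part[OF parity(5) parity(6)] by (simp add: w0_def)

lemma h0_x0: "n \<ge> 0 \<Longrightarrow> h0 \<lbrace>n\<rbrace> x0 = (if n = 0 then x0 else 0)"
  by (rule eq_by_functionals) (simp add: h0_modes, simp add: field_defs wick)

lemma h0_y0: "n \<ge> 0 \<Longrightarrow> h0 \<lbrace>n\<rbrace> y0 = (if n = 0 then - y0 else 0)"
  by (rule eq_by_functionals) (simp add: h0_modes, simp add: field_defs wick)

lemma E_x0: "n \<ge> 0 \<Longrightarrow> E 2 \<lbrace>n\<rbrace> x0 = 0"
  by (simp add: field_defs wick)

lemma x0_modes:
  assumes "\<And>j. j \<ge> N \<Longrightarrow> E 1 \<lbrace>n + int j\<rbrace> v = 0" "\<And>j. j \<ge> N \<Longrightarrow> \<psi> \<lbrace>int j\<rbrace> v = 0"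
  shows "x0 \<lbrace>n\<rbrace> v = (\<Sum>j<N. \<psi> \<lbrace>-1 - int j\<rbrace> (E 1 \<lbrace>n + int j\<rbrace> v) + E 1 \<lbrace>n - 1 - int j\<rbrace> (\<psi> \<lbrace>int j\<rbrace> v))"
  unfolding x0_def
  by (subst iterate_minus_1[OF parity(3,6) assms]) (simp_all add: super_sign_def)

lemma x0_x0: "n \<ge> 0 \<Longrightarrow> x0 \<lbrace>n\<rbrace> x0 = (if n = 0 then E 2 else 0)"
  by (subst x0_modes[where N = 1]) (auto simp: field_defs wick)

lemma \<psi>_y0: "n \<ge> 0 \<Longrightarrow> \<psi> \<lbrace>n\<rbrace> y0 = (if n = 0 then w0 else if n = 1 then - E (-1) else 0)"
  by (simp add: field_defs wick)

lemma E1_y0: "n \<ge> 0 \<Longrightarrow> E 1 \<lbrace>n\<rbrace> y0 = (if n = 0 then (- 1 / 2) \<odot> \<psi> \<lbrace>-1\<rbrace> E 0 else 0)"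
  by (cases "n = 0") (simp_all add: field_defs wick)

text \<open>Scaling both factors by \<open>sqrt 2\<close> turns \<open>- 3 / 2\<close> into
  \<open>2 k\<close>, in agreement with \<open>(x, y) = 2\<close>.\<close>

lemma x0_y0:
  "x0 \<lbrace>0\<rbrace> y0 = (1 / 2) \<odot> h0"
  "x0 \<lbrace>1\<rbrace> y0 = (- 3 / 2) \<odot> E 0"
  "n \<ge> 2 \<Longrightarrow> x0 \<lbrace>n\<rbrace> y0 = 0"
proof -
  \<comment> \<open>The term with \<open>E 1_(n+1) y0\<close> is absent because it vanishes for
    \<open>n \<ge> 0\<close>.\<close>
  have x0: "x0 \<lbrace>n\<rbrace> y0 = \<psi> \<lbrace>-1\<rbrace> (E 1 \<lbrace>n\<rbrace> y0) + E 1 \<lbrace>n - 1\<rbrace> w0 - E 1 \<lbrace>n - 2\<rbrace> E (-1)" if "n \<ge> 0" for n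
    using that by (subst x0_modes[where N = 2]) (simp_all add: \<psi>_y0 E1_y0 numeral_2_eq_2 algebra_simps)
  show "x0 \<lbrace>0\<rbrace> y0 = (1 / 2) \<odot> h0"
    by (rule eq_by_functionals) (simp add: x0 E1_y0, simp add: field_defs wick)
  show "x0 \<lbrace>1\<rbrace> y0 = (- 3 / 2) \<odot> E 0"
    by (rule eq_by_functionals) (simp add: x0 E1_y0, simp add: field_defs wick)
  show "n \<ge> 2 \<Longrightarrow> x0 \<lbrace>n\<rbrace> y0 = 0"
    by (simp add: x0 E1_y0, simp add: field_defs wick)
qed

section \<open>The products of y with itself\<close>

lemma w0_modes:
  assumes "\<And>j. j \<ge> N \<Longrightarrow> E (-1) \<lbrace>n + int j\<rbrace> v = 0" "\<And>j. j \<ge> N \<Longrightarrow> \<nu> \<lbrace>int j\<rbrace> v = 0"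
  shows "w0 \<lbrace>n\<rbrace> v = (\<Sum>j<N. \<nu> \<lbrace>-1 - int j\<rbrace> (E (-1) \<lbrace>n + int j\<rbrace> v) + E (-1) \<lbrace>n - 1 - int j\<rbrace> (\<nu> \<lbrace>int j\<rbrace> v))"
  unfolding w0_def
  by (subst iterate_minus_1[OF parity(5,6) assms]) (simp_all add: super_sign_def)

lemma y0_modes:
  assumes "\<And>j. j \<ge> N \<Longrightarrow> E (-1) \<lbrace>n + int j\<rbrace> v = 0" "\<And>j. j \<ge> N \<Longrightarrow> w0 \<lbrace>n + int j\<rbrace> v = 0"
    and "\<And>j. j \<ge> N \<Longrightarrow> g \<lbrace>int j\<rbrace> v = 0" "\<And>j. j \<ge> N \<Longrightarrow> \<psi> \<lbrace>int j\<rbrace> v = 0"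
  shows "y0 \<lbrace>n\<rbrace> v =
     (- \<i> / 2) \<odot> (\<Sum>j<N. g \<lbrace>-1 - int j\<rbrace> (E (-1) \<lbrace>n + int j\<rbrace> v) + E (-1) \<lbrace>n - 1 - int j\<rbrace> (g \<lbrace>int j\<rbrace> v))
     + (\<Sum>j<N. \<psi> \<lbrace>-1 - int j\<rbrace> (w0 \<lbrace>n + int j\<rbrace> v) + w0 \<lbrace>n - 1 - int j\<rbrace> (\<psi> \<lbrace>int j\<rbrace> v))
     - (\<Sum>j<N. of_nat (Suc j) \<odot> (\<psi> \<lbrace>-2 - int j\<rbrace> (E (-1) \<lbrace>n + int j\<rbrace> v) - E (-1) \<lbrace>n - 2 - int j\<rbrace> (\<psi> \<lbrace>int j\<rbrace> v)))"
proof -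
  have 1: "(g \<lbrace>-1\<rbrace> E (-1)) \<lbrace>n\<rbrace> v
      = (\<Sum>j<N. g \<lbrace>-1 - int j\<rbrace> (E (-1) \<lbrace>n + int j\<rbrace> v) + E (-1) \<lbrace>n - 1 - int j\<rbrace> (g \<lbrace>int j\<rbrace> v))"
    by (subst iterate_minus_1[OF parity(1,6), where N = N]) (simp_all add: assms super_sign_def)
  have 2: "(\<psi> \<lbrace>-1\<rbrace> w0) \<lbrace>n\<rbrace> v
      = (\<Sum>j<N. \<psi> \<lbrace>-1 - int j\<rbrace> (w0 \<lbrace>n + int j\<rbrace> v) + w0 \<lbrace>n - 1 - int j\<rbrace> (\<psi> \<lbrace>int j\<rbrace> v))"
    by (subst iterate_minus_1[OF parity(3) w0_even, where N = N]) (simp_all add: assms super_sign_def)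
  have 3: "(\<psi> \<lbrace>-2\<rbrace> E (-1)) \<lbrace>n\<rbrace> v = (\<Sum>j<N. of_nat (Suc j) \<odot>
      (\<psi> \<lbrace>-2 - int j\<rbrace> (E (-1) \<lbrace>n + int j\<rbrace> v) - E (-1) \<lbrace>n - 2 - int j\<rbrace> (\<psi> \<lbrace>int j\<rbrace> v)))"
    by (subst iterate_minus_2[OF parity(3,6), where N = N]) (simp_all add: assms super_sign_def)
  show ?thesis
    unfolding y0_def product_left 1 2 3 ..
qed

text \<open>This and the next three lemmas record how the constituents of \<open>y0\<close> act on
  it; \<open>y0_modes\<close> assembles them.\<close>

lemma g_y0: "n \<ge> 0 \<Longrightarrow> g \<lbrace>n\<rbrace> y0 =
    (if n = 0 then (- \<i>) \<odot> \<tau> \<lbrace>-1\<rbrace> E (-1) else if n = 2 then \<i> \<odot> E (-1) else 0)"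
  by (cases "n = 0"; cases "n = 1"; cases "n = 2") (simp_all add: field_defs wick vs.scale_minus_left)

lemma \<nu>_y0: "n \<ge> 0 \<Longrightarrow> \<nu> \<lbrace>n\<rbrace> y0 =
    (if n = 0 then (- 1 / 2) \<odot> y0 else if n = 1 then (3 / 4) \<odot> \<psi> \<lbrace>-1\<rbrace> E (-1) else 0)"
  by (rule eq_by_functionals) (simp add: field_defs wick field_simps)

lemma E_y0: "n \<ge> 0 \<Longrightarrow> E (-1) \<lbrace>n\<rbrace> y0 = (if n = 0 then (1 / 2) \<odot> \<psi> \<lbrace>-1\<rbrace> E (-2) else 0)"
  by (cases "n = 0") (simp_all add: field_defs wick)

lemma w0_y0:
  assumes "n \<ge> 0"
  shows "w0 \<lbrace>n\<rbrace> y0 = \<nu> \<lbrace>-1\<rbrace> (E (-1) \<lbrace>n\<rbrace> y0) + \<nu> \<lbrace>-2\<rbrace> (E (-1) \<lbrace>n+1\<rbrace> y0)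
    - (1 / 2) \<odot> E (-1) \<lbrace>n - 1\<rbrace> y0 + (3 / 4) \<odot> \<psi> \<lbrace>-1\<rbrace> (E (-1) \<lbrace>n - 2\<rbrace> (E (-1)))"
   using assms by (subst w0_modes[where N = 2], simp_all add: \<nu>_y0 E_y0 numeral_2_eq_2 algebra_simps move_E)

text \<open>From \<open>n \<ge> -2\<close> on, \<open>E (-1)_(n+j) E s\<close> vanishes for
  \<open>j \<ge> 2\<close>, so two terms suffice.\<close>

lemma w0_E:
  assumes "n \<ge> -2"
  shows "w0 \<lbrace>n\<rbrace> E s = \<nu> \<lbrace>-1\<rbrace> (E (-1) \<lbrace>n\<rbrace> E s) + \<nu> \<lbrace>-2\<rbrace> (E (-1) \<lbrace>n + 1\<rbrace> E s)
    + (of_int s / 2) \<odot> E (-1) \<lbrace>n - 1\<rbrace> E s"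
  using assms by (subst w0_modes[where N = 2]) (simp_all add: wick numeral_2_eq_2 algebra_simps)

lemma move_w0:
  "w0 \<lbrace>m\<rbrace> (g \<lbrace>n\<rbrace> v) = g \<lbrace>n\<rbrace> (w0 \<lbrace>m\<rbrace> v)"
  "w0 \<lbrace>m\<rbrace> (\<psi> \<lbrace>n\<rbrace> v) = \<psi> \<lbrace>n\<rbrace> (w0 \<lbrace>m\<rbrace> v)"
  using regular_commute[OF parity(1) w0_even, where m = n and n = m and v = v]
    regular_commute[OF parity(3) w0_even, where m = n and n = m and v = v]
  by (simp_all add: w0_def wick super_sign_def)

text \<open>The bound is one higher than in \<open>w0_E\<close>, since passing \<nu> lowers the
  index of \<open>E (-1)\<close> by one.\<close>

lemma w0_w0:
  assumes "n \<ge> -1"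
  shows "w0 \<lbrace>n\<rbrace> w0 = \<nu> \<lbrace>-1\<rbrace> (E (-1) \<lbrace>n\<rbrace> w0) + \<nu> \<lbrace>-2\<rbrace> (E (-1) \<lbrace>n + 1\<rbrace> w0)
    - (1 / 2) \<odot> E (-1) \<lbrace>n - 1\<rbrace> w0 + (3 / 4) \<odot> E (-1) \<lbrace>n - 2\<rbrace> E (-1)"
proof -
  have "\<nu> \<lbrace>int j\<rbrace> w0 = (if j = 0 then (- 1 / 2) \<odot> w0 else if j = 1 then (3 / 4) \<odot> E (-1) else 0)" for j
    by (simp add: w0_def wick)
  moreover have "E (-1) \<lbrace>n + int j\<rbrace> w0 = 0" if "j \<ge> 2" for j
    using that assms by (simp add: w0_def wick)
  ultimately show ?thesis
    by (subst w0_modes[where N = 2]) (simp_all add: numeral_2_eq_2 algebra_simps)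
qed

lemma y0_y0:
  "y0 \<lbrace>0\<rbrace> y0 = - f0"
  "y0 \<lbrace>1\<rbrace> y0 = 0"
  "n \<ge> 2 \<Longrightarrow> y0 \<lbrace>n\<rbrace> y0 = 0"
proof -
  \<comment> \<open>Three terms are needed because \<open>g_2 y0\<close> is non-zero.\<close>
  have y0: "y0 \<lbrace>n\<rbrace> y0 =
     (- \<i> / 2) \<odot> (\<Sum>j<3. g \<lbrace>-1 - int j\<rbrace> (E (-1) \<lbrace>n + int j\<rbrace> y0) + E (-1) \<lbrace>n - 1 - int j\<rbrace> (g \<lbrace>int j\<rbrace> y0))
     + (\<Sum>j<3. \<psi> \<lbrace>-1 - int j\<rbrace> (w0 \<lbrace>n + int j\<rbrace> y0) + w0 \<lbrace>n - 1 - int j\<rbrace> (\<psi> \<lbrace>int j\<rbrace> y0))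
     - (\<Sum>j<3. of_nat (Suc j) \<odot> (\<psi> \<lbrace>-2 - int j\<rbrace> (E (-1) \<lbrace>n + int j\<rbrace> y0) - E (-1) \<lbrace>n - 2 - int j\<rbrace> (\<psi> \<lbrace>int j\<rbrace> y0)))"
     if "n \<ge> 0" for n
    using that by (subst y0_modes[where N = 3]) (simp_all add: E_y0 w0_y0 g_y0 \<psi>_y0 move_E E_E)
  note expand = y0 numeral_3_eq_3 E_y0 w0_y0 g_y0 \<psi>_y0 w0_w0 w0_E
  show "y0 \<lbrace>0\<rbrace> y0 = - f0"
    by (rule eq_by_functionals)
      (simp add: expand, simp add: field_defs wick, simp add: field_simps power2_eq_square)
  show "y0 \<lbrace>1\<rbrace> y0 = 0"
    by (rule eq_by_functionals) (simp add: expand, simp add: field_defs wick)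
  show "y0 \<lbrace>n\<rbrace> y0 = 0" if "n \<ge> 2"
    using that by - (rule eq_by_functionals, simp add: expand, simp add: field_defs wick)
qed

section \<open>The product of y with f, and the Sugawara vector\<close>

lemma g_f0: "n \<ge> 0 \<Longrightarrow> g \<lbrace>n\<rbrace> f0 = (if n = 0 then \<i> \<odot> \<psi> \<lbrace>-1\<rbrace> (\<tau> \<lbrace>-1\<rbrace> E (-2))
    else if n = 2 then (- \<i>) \<odot> \<psi> \<lbrace>-1\<rbrace> E (-2) else 0)"
  by (rule eq_by_functionals) (cases "n = 0"; cases "n = 1"; cases "n = 2"; simp add: field_defs wick)

lemma \<psi>_f0: "n \<ge> 0 \<Longrightarrow> \<psi> \<lbrace>n\<rbrace> f0 = (if n = 0 then - ((\<i> / 2) \<odot> g \<lbrace>-1\<rbrace> E (-2) + (1 / 2) \<odot> \<psi> \<lbrace>-2\<rbrace> E (-2))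
    else if n = 1 then (1 / 2) \<odot> \<psi> \<lbrace>-1\<rbrace> E (-2) else 0)"
  by (rule eq_by_functionals) (simp add: field_defs wick)

lemma \<nu>_f0: "n \<ge> 0 \<Longrightarrow> \<nu> \<lbrace>n\<rbrace> f0 = (if n = 0 then - f0 else if n = 1 then (- 3 / 2) \<odot> \<nu> \<lbrace>-1\<rbrace> E (-2)
    else if n = 2 then (3 / 4) \<odot> E (-2) else 0)"
  by (rule eq_by_functionals) (simp add: field_defs wick, simp add: field_simps)

lemma E_f0: "n \<ge> 0 \<Longrightarrow> E (-1) \<lbrace>n\<rbrace> f0 = (if n = 0 then - \<nu> \<lbrace>-1\<rbrace> E (-3) else 0)"
  by (rule eq_by_functionals) (cases "n = 0"; simp add: field_defs wick; simp add: field_simps)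

lemma w0_f0:
  assumes "n \<ge> 0"
  shows "w0 \<lbrace>n\<rbrace> f0 = \<nu> \<lbrace>-1\<rbrace> (E (-1) \<lbrace>n\<rbrace> f0) + \<nu> \<lbrace>-2\<rbrace> (E (-1) \<lbrace>n + 1\<rbrace> f0)
     - E (-1) \<lbrace>n - 1\<rbrace> f0 - (3 / 2) \<odot> E (-1) \<lbrace>n - 2\<rbrace> (\<nu> \<lbrace>-1\<rbrace> E (-2)) + (3 / 4) \<odot> E (-1) \<lbrace>n - 3\<rbrace> E (-2)"
  using assms by (subst w0_modes[where N = 3])
    (simp_all add: \<nu>_f0 E_f0 numeral_3_eq_3 algebra_simps)

text \<open>This is the input \<open>y_1 f = 0\<close> of \<open>osp_current_opes\<close>, beyond
  the products of \<open>x\<close>, \<open>y\<close> and \<open>h\<close>, \<open>e\<close> with the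
  odd currents.\<close>

lemma y0_f0: "y0 \<lbrace>1\<rbrace> f0 = 0"
proof -
  have w: "w0 \<lbrace>1 + int j\<rbrace> f0 = 0" if "j \<ge> 3" for j
    using that by (simp add: E_f0 w0_f0 wick)
  have "y0 \<lbrace>1\<rbrace> f0 =
     (- \<i> / 2) \<odot> (\<Sum>j<3. g \<lbrace>-1 - int j\<rbrace> (E (-1) \<lbrace>1 + int j\<rbrace> f0) + E (-1) \<lbrace>1 - 1 - int j\<rbrace> (g \<lbrace>int j\<rbrace> f0))
     + (\<Sum>j<3. \<psi> \<lbrace>-1 - int j\<rbrace> (w0 \<lbrace>1 + int j\<rbrace> f0) + w0 \<lbrace>1 - 1 - int j\<rbrace> (\<psi> \<lbrace>int j\<rbrace> f0))
     - (\<Sum>j<3. of_nat (Suc j) \<odot> (\<psi> \<lbrace>-2 - int j\<rbrace> (E (-1) \<lbrace>1 + int j\<rbrace> f0) - E (-1) \<lbrace>1 - 2 - int j\<rbrace> (\<psi> \<lbrace>int j\<rbrace> f0)))"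
    by (rule y0_modes) (simp_all add: E_f0 w g_f0 \<psi>_f0)
  then show ?thesis
    by - (rule eq_by_functionals, simp add: numeral_3_eq_3 E_f0 w0_f0 g_f0 \<psi>_f0 w0_E move_w0,
        simp add: field_defs wick, simp add: field_simps power2_eq_square)
qed

text \<open>Up to normalization this is the Sugawara vector \<open>e_(-1) f + f_(-1) e + h_(-1) h /
  2 - (x_(-1) y - y_(-1) x) / 2\<close>; skew-symmetry of its second and last term produces
  \<open>- h_(-2) 1 / 2\<close>. The factor 2 of \<open>x0\<close> and \<open>y0\<close> is the
  square of \<open>sqrt 2\<close>.\<close>

lemma sugawara:
  "2 \<odot> E 2 \<lbrace>-1\<rbrace> f0 - 2 \<odot> x0 \<lbrace>-1\<rbrace> y0 + (1 / 2) \<odot> h0 \<lbrace>-1\<rbrace> h0 - (1 / 2) \<odot> h0 \<lbrace>-2\<rbrace> \<one> = \<tau>"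
proof -
  \<comment> \<open>Unlike for \<open>n \<ge> 0\<close>, the term with \<open>E 1_0 y0\<close>
    survives.\<close>
  have 1: "x0 \<lbrace>-1\<rbrace> y0 = \<psi> \<lbrace>-1\<rbrace> (E 1 \<lbrace>-1\<rbrace> y0) + \<psi> \<lbrace>-2\<rbrace> (E 1 \<lbrace>0\<rbrace> y0) + E 1 \<lbrace>-2\<rbrace> w0 - E 1 \<lbrace>-3\<rbrace> E (-1)"
    by (subst x0_modes[where N = 2]) (simp_all add: \<psi>_y0 E1_y0 numeral_2_eq_2 algebra_simps)
  have "2 \<odot> E 2 \<lbrace>-1\<rbrace> f0 - 2 \<odot> x0 \<lbrace>-1\<rbrace> y0 + (1 / 2) \<odot> h0 \<lbrace>-1\<rbrace> h0 - (1 / 2) \<odot> h0 \<lbrace>-2\<rbrace> E 0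
      = \<tau> \<lbrace>-1\<rbrace> E 0"
    unfolding 1 h0_modes E1_y0
    by (rule eq_by_functionals) (simp add: field_defs wick, simp add: field_simps power2_eq_square)
  then show ?thesis
    by (simp add: E_0)
qed

section \<open>The currents at level -3/2\<close>

fun osp_field :: "osp \<Rightarrow> 'w" where
  "osp_field osp_e = E 2"
| "osp_field osp_f = f0"
| "osp_field osp_h = h0"
| "osp_field osp_x = complex_of_real (sqrt 2) \<odot> x0"
| "osp_field osp_y = complex_of_real (sqrt 2) \<odot> y0"

lemma osp_field_part: "osp_field a \<in> part V (osp_odd a)"
proof -
  have parity_E: "g \<lbrace>n\<rbrace> E r \<in> part V True" "\<psi> \<lbrace>n\<rbrace> E r \<in> part V True" "\<tau> \<lbrace>n\<rbrace> E r \<in> part V False"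
    "\<nu> \<lbrace>n\<rbrace> E r \<in> part V False" "c \<lbrace>n\<rbrace> E r \<in> part V False" "\<psi> \<lbrace>n\<rbrace> w0 \<in> part V True" for n r
    using nprod_part[OF parity(1,6)] nprod_part[OF parity(3,6)] nprod_part[OF parity(2,6)]
      nprod_part[OF parity(5,6)] nprod_part[OF parity(4,6)] nprod_part[OF parity(3) w0_even]
    by simp_all
  have "g \<lbrace>m\<rbrace> (\<psi> \<lbrace>n\<rbrace> E r) \<in> part V False" "\<psi> \<lbrace>m\<rbrace> (\<psi> \<lbrace>n\<rbrace> E r) \<in> part V False"
    "\<nu> \<lbrace>m\<rbrace> (\<nu> \<lbrace>n\<rbrace> E r) \<in> part V False" for m n r
    using nprod_part[OF parity(1) parity_E(2)] nprod_part[OF parity(3) parity_E(2)] nprod_part[OF parity(5) parity_E(4)]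
    by simp_all
  with parity_E show ?thesis
    by (cases a) (auto simp: x0_def y0_def h0_def f0_def parity)
qed

lemma osp_field_ope:
  "current_ope (osp_field a) (osp_field b) (\<Sum>i\<in>UNIV. osp_bracket a b i \<odot> osp_field i)
     (osp_form a b * (- 3 / 2))"
proof -
  let ?s = "complex_of_real (sqrt 2)"
  let ?x = "?s \<odot> x0" and ?y = "?s \<odot> y0"
  have s: "?s * ?s = 2"
    by (simp flip: of_real_mult)
  \<comment> \<open>This passes from \<open>x0\<close>, \<open>y0\<close> to the odd generators,
    each of which carries a factor \<open>sqrt 2\<close>.\<close>
  have scaled: "current_ope (?s \<odot> a) (?s \<odot> b) (2 \<odot> u) (2 * \<kappa>)" if "current_ope a b u \<kappa>" for a b u \<kappa>
    using current_ope_scale(2)[OF current_ope_scale(1)[OF that, of ?s], of ?s]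
    by (simp add: s mult.assoc[symmetric])
  have "current_ope ?x ?x (2 \<odot> E 2) 0"
    using scaled[of x0 x0 "E 2" 0] by (simp add: current_ope_def x0_x0)
  moreover have "current_ope ?x ?y h0 (2 * (- 3 / 2))"
    using scaled[of x0 y0 "(1 / 2) \<odot> h0" "- 3 / 2"] x0_y0 by (simp add: current_ope_def E_0)
  moreover have "current_ope ?y ?y ((- 2) \<odot> f0) 0"
    using scaled[of y0 y0 "- f0" 0] y0_y0 by (simp add: current_ope_def)
  moreover have "current_ope h0 ?x ?x 0" "current_ope h0 ?y (- ?y) 0" "current_ope (E 2) ?x 0 0"
    by (simp_all add: current_ope_def h0_x0 h0_y0 E_x0)
  moreover have "?y \<lbrace>1\<rbrace> f0 = 0"
    by (simp add: y0_f0)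
  moreover have "E 2 \<in> part V False" "f0 \<in> part V False" "h0 \<in> part V False"
    "?x \<in> part V True" "?y \<in> part V True"
    using osp_field_part[of osp_e] osp_field_part[of osp_f] osp_field_part[of osp_h]
      osp_field_part[of osp_x] osp_field_part[of osp_y] by (simp_all only: osp_field.simps osp_odd.simps)
  ultimately show ?thesis
    by (intro osp_current_opes[of "E 2" f0 h0 ?x ?y]) simp_all
qed

lemma osp_field_sugawara:
  "2 \<odot> osp_field osp_e \<lbrace>-1\<rbrace> osp_field osp_f - osp_field osp_x \<lbrace>-1\<rbrace> osp_field osp_y
   + (1 / 2) \<odot> osp_field osp_h \<lbrace>-1\<rbrace> osp_field osp_h - (1 / 2) \<odot> osp_field osp_h \<lbrace>-2\<rbrace> \<one> = \<tau>"
proof -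
  have "complex_of_real (sqrt 2) * complex_of_real (sqrt 2) = 2"
    by (simp flip: of_real_mult)
  then show ?thesis
    using sugawara by simp
qed

end

section \<open>The universal property of the universal affine vertex superalgebra\<close>

lemma (in vertex_superalgebra) word_eval_superset:
  assumes "finite S" "Poly_Mapping.keys P \<subseteq> S"
  shows "word_eval V g P = (\<Sum>w\<in>S. Poly_Mapping.lookup P w \<odot> mode_word V g w \<one>)"
  unfolding word_eval_def
  by (rule sum.mono_neutral_left) (use assms in \<open>auto simp: in_keys_iff\<close>)

lemma (in vertex_superalgebra) word_eval_add:
  "word_eval V g (P + Q) = word_eval V g P + word_eval V g Q"
proof -
  \<comment> \<open>Keys may cancel in \<open>P + Q\<close>, so all three sums are taken over the
    union.\<close>
  let ?S = "Poly_Mapping.keys P \<union> Poly_Mapping.keys Q"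
  have *: "word_eval V g R = (\<Sum>w\<in>?S. Poly_Mapping.lookup R w \<odot> mode_word V g w \<one>)"
    if "R \<in> {P, Q, P + Q}" for R
    using that Poly_Mapping.keys_add[of P Q] by (intro word_eval_superset) auto
  show ?thesis
    by (simp add: * lookup_add vs.scale_left_distrib sum.distrib)
qed

lemma (in vertex_superalgebra) word_eval_diff:
  "word_eval V g (P - Q) = word_eval V g P - word_eval V g Q"
  using word_eval_add[of g "P - Q" Q] by (simp add: algebra_simps)

lemma (in vertex_superalgebra) word_eval_zero: "word_eval V g 0 = 0"
  by (simp add: word_eval_def)

lemma (in vertex_superalgebra) word_eval_sum:
  "word_eval V g (sum P I) = (\<Sum>i\<in>I. word_eval V g (P i))"
  by (induction I rule: infinite_finite_induct) (simp_all add: word_eval_add word_eval_zero)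

lemma (in vertex_superalgebra) word_eval_single:
  "word_eval V g (Poly_Mapping.single w z) = z \<odot> mode_word V g w \<one>"
  by (subst word_eval_superset[of "{w}"]) auto

lemma (in vertex_superalgebra) word_eval_scale:
  "word_eval V g (Poly_Mapping.map ((*) z) P) = z \<odot> word_eval V g P"
proof -
  have "word_eval V g (Poly_Mapping.map ((*) z) P)
      = (\<Sum>w\<in>Poly_Mapping.keys P. Poly_Mapping.lookup (Poly_Mapping.map ((*) z) P) w \<odot> mode_word V g w \<one>)"
    by (intro word_eval_superset) (auto simp: in_keys_iff Poly_Mapping.map.rep_eq when_def)
  also have "\<dots> = (\<Sum>w\<in>Poly_Mapping.keys P. z \<odot> (Poly_Mapping.lookup P w \<odot> mode_word V g w \<one>))"
    by (intro sum.cong) (auto simp: Poly_Mapping.map.rep_eq when_def in_keys_iff)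
  finally show ?thesis
    by (simp add: word_eval_def vs.scale_sum_right)
qed

lemma mode_word_simps [simp]:
  "mode_word V g [] v = v"
  "mode_word V g (x # w) v = nprod V (g (fst x)) (snd x) (mode_word V g w v)"
  "mode_word V g (u @ w) v = mode_word V g u (mode_word V g w v)"
  by (simp_all add: mode_word_def split_beta)

lemma (in vertex_superalgebra) mode_word_linear:
  "mode_word V g w (u + v) = mode_word V g w u + mode_word V g w v"
  "mode_word V g w (u - v) = mode_word V g w u - mode_word V g w v"
  "mode_word V g w (z \<odot> v) = z \<odot> mode_word V g w v"
  "mode_word V g w 0 = 0"
  "mode_word V g w (sum f I) = (\<Sum>i\<in>I. mode_word V g w (f i))"
  by (induction w) simp_all

fun word_parity :: "('i \<Rightarrow> bool) \<Rightarrow> ('i \<times> int) list \<Rightarrow> bool" where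
  "word_parity p [] = False"
| "word_parity p (x # w) = (p (fst x) \<noteq> word_parity p w)"

lemma (in vertex_superalgebra) mode_word_part:
  assumes "\<And>i. g i \<in> part V (p i)"
  shows "mode_word V g w \<one> \<in> part V (word_parity p w)"
  by (induction w) (use vac_even nprod_part[OF assms] in auto)

section \<open>Extension of currents to a homomorphism\<close>

locale current_realization =
  V: universal_affine V p br B k J + W: vertex_superalgebra W
  for V :: "'v::ab_group_add vsa" and p :: "'i::finite \<Rightarrow> bool" and br B k J
    and W :: "'w::ab_group_add vsa" +
  fixes K :: "'i \<Rightarrow> 'w"
  assumes K_part: "\<And>a. K a \<in> part W (p a)"
    and K_ope: "\<And>a b. W.current_ope (K a) (K b) (\<Sum>i\<in>UNIV. smul W (br a b i) (K i)) (B a b * k)"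
begin

lemma word_eval_affine_rel:
  assumes "P \<in> affine_rel p br B k"
  shows "word_eval W K P = 0"
  using assms
proof induction
  case zero
  then show ?case by (simp add: W.word_eval_zero)
next
  case (add P Q)
  then show ?case by (simp add: W.word_eval_add)
next
  case (commutator u a m b n w z)
  define v where "v = mode_word W K w (vac W)"
  have "nprod W (\<Sum>i\<in>UNIV. smul W (br a b i) (K i)) (m + n) v
      = (\<Sum>i\<in>UNIV. smul W (br a b i) (nprod W (K i) (m + n) v))"
  proof -
    interpret l: Vector_Spaces.linear "smul W" "smul W" "\<lambda>a. nprod W a (m + n) v"
      by (rule W.linear_left)
    show ?thesis by (simp only: l.sum l.scale)
  qed
  then show ?case
    using W.current_ope_commutator[OF K_ope[of a b] K_part K_part, where m = m and n = n and v = v]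
    by (simp add: W.word_eval_diff W.word_eval_add W.word_eval_sum W.word_eval_single W.mode_word_linear
        v_def[symmetric] W.vs.scale_right_distrib W.vs.scale_sum_right algebra_simps
        cong: if_cong)
next
  case (annihilation n u a z)
  then show ?case by (simp add: W.word_eval_single W.mode_word_linear)
qed

definition realization :: "'v \<Rightarrow> 'w" where
  "realization v = word_eval W K (SOME P. word_eval V J P = v)"

text \<open>The chosen word is immaterial: two words with the same value in \<open>V\<close> differ
  by a relation, and relations evaluate to 0 in \<open>W\<close>.\<close>

lemma realization_word_eval: "realization (word_eval V J P) = word_eval W K P"
proof -
  define Q where "Q = (SOME Q. word_eval V J Q = word_eval V J P)"
  have "word_eval V J Q = word_eval V J P"
    unfolding Q_def by (rule someI) (rule refl)
  then have "word_eval V J (Q - P) = 0"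
    by (simp add: V.word_eval_diff)
  then have "word_eval W K (Q - P) = 0"
    by (simp add: V.kernel_word_eval word_eval_affine_rel)
  then show ?thesis
    by (simp add: W.word_eval_diff realization_def Q_def)
qed

lemma word_eval_cases: obtains P where "v = word_eval V J P"
  using V.surj_word_eval by (metis surjD)

lemma realization_linear:
  "realization (u + v) = realization u + realization v"
  "realization (smul V z v) = smul W z (realization v)"
proof -
  obtain P Q where "u = word_eval V J P" "v = word_eval V J Q"
    using word_eval_cases by metis
  then show "realization (u + v) = realization u + realization v"
    "realization (smul V z v) = smul W z (realization v)"
    by (simp_all add: realization_word_eval V.word_eval_add[symmetric] V.word_eval_scale[symmetric])
      (simp_all add: W.word_eval_add W.word_eval_scale)
qed

sublocale realization: Vector_Spaces.linear "smul V" "smul W" realization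
  by (simp add: Vector_Spaces.linear_iff V.vector_space W.vector_space realization_linear)

lemma realization_mode_word: "realization (mode_word V J w (vac V)) = mode_word W K w (vac W)"
  using realization_word_eval[of "Poly_Mapping.single w 1"]
  by (simp add: V.word_eval_single W.word_eval_single)

lemma realization_vac: "realization (vac V) = vac W"
  using realization_mode_word[of "[]"] by simp

lemma realization_generator: "realization (J a) = K a"
  using realization_mode_word[of "[(a, -1)]"] by simp

lemma span_induct [consumes 0, case_names add word]:
  assumes "\<And>u v. Q u \<Longrightarrow> Q v \<Longrightarrow> Q (u + v)"
    and "\<And>w z. Q (smul V z (mode_word V J w (vac V)))"
  shows "Q v"
proof -
  obtain P where v: "v = word_eval V J P"
    by (rule word_eval_cases)
  have "Q (\<Sum>w\<in>S. smul V (Poly_Mapping.lookup P w) (mode_word V J w (vac V)))" if "finite S" for S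
    using that
  proof induction
    case empty
    show ?case using assms(2)[of 0 "[]"] by simp
  next
    case (insert w S)
    then show ?case using assms by simp
  qed
  then show ?thesis
    by (simp add: v word_eval_def)
qed

text \<open>On a word, a generator mode just prepends a letter.\<close>

lemma realization_generator_product:
  "realization (nprod V (J a) n v) = nprod W (K a) n (realization v)"
proof (induction v rule: span_induct)
  case (add u v)
  then show ?case by (simp add: realization.add)
next
  case (word w z)
  have "realization (nprod V (J a) n (mode_word V J w (vac V)))
      = nprod W (K a) n (realization (mode_word V J w (vac V)))"
    using realization_mode_word[of "(a, n) # w"] by (simp add: realization_mode_word)
  then show ?case
    by (simp add: realization.scale)
qed

text \<open>Induction on the word: the iterate formula reduces a product by \<open>J i_(m) a\<close>
  to modes of \<open>J i\<close> and of \<open>a\<close>.\<close>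

lemma realization_product_word:
  "realization (nprod V (mode_word V J w (vac V)) n v)
    = nprod W (mode_word W K w (vac W)) n (realization v)"
proof (induction w arbitrary: n v)
  case Nil
  show ?case by (simp add: realization_vac realization.zero)
next
  case (Cons x w)
  obtain i m where x: "x = (i, m)" by (cases x)
  let ?a = "mode_word V J w (vac V)" and ?b = "mode_word W K w (vac W)"
  let ?s = "super_sign (p i) (word_parity p w) * (- 1) powi m"
  obtain N1 where N1: "\<And>n. n \<ge> N1 \<Longrightarrow> nprod V ?a n v = 0"
    using V.field by blast
  obtain N2 where N2: "\<And>n. n \<ge> N2 \<Longrightarrow> nprod V (J i) n v = 0"
    using V.field by blast
  \<comment> \<open>One bound truncates both sums: vanishing in \<open>W\<close> is inherited from
    \<open>V\<close> through the induction hypothesis.\<close>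
  let ?N = "nat (max (N1 - n) N2)"
  have N: "nprod V ?a (n + int j) v = 0" "nprod V (J i) (int j) v = 0" if "j \<ge> ?N" for j
    using that by (auto intro!: N1 N2)
  have N': "nprod W ?b (n + int j) (realization v) = 0" "nprod W (K i) (int j) (realization v) = 0"
    if "j \<ge> ?N" for j
    using N[OF that] Cons.IH[of "n + int j" v] realization_generator_product[of i "int j" v]
    by (simp_all add: realization.zero)
  have "nprod V (nprod V (J i) m ?a) n v = (\<Sum>j<?N. smul V ((-1) ^ j * (of_int m gchoose j))
      (nprod V (J i) (m - int j) (nprod V ?a (n + int j) v)
        - smul V ?s (nprod V ?a (m + n - int j) (nprod V (J i) (int j) v))))"
    unfolding V.iterate_formula[OF V.J_part V.mode_word_part[where g = J, OF V.J_part]]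
    by (rule Sum_any_eq_sum_lessThan) (simp add: N)
  moreover have "nprod W (nprod W (K i) m ?b) n (realization v) =
    (\<Sum>j<?N. smul W ((-1) ^ j * (of_int m gchoose j))
      (nprod W (K i) (m - int j) (nprod W ?b (n + int j) (realization v))
        - smul W ?s (nprod W ?b (m + n - int j) (nprod W (K i) (int j) (realization v)))))"
    unfolding W.iterate_formula[OF K_part W.mode_word_part[where g = K, OF K_part]]
    by (rule Sum_any_eq_sum_lessThan) (simp add: N')
  ultimately show ?case
    by (simp add: x realization.sum realization.scale realization.diff
        realization_generator_product Cons.IH)
qed

lemma realization_product: "realization (nprod V a n v) = nprod W (realization a) n (realization v)"
proof (induction a rule: span_induct)
  case (add a b)
  then show ?case by (simp add: realization.add)
next
  case (word w z)
  then show ?case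
    by (simp add: realization.scale realization_product_word realization_mode_word)
qed

lemma realization_part:
  assumes "v \<in> part V q"
  shows "realization v \<in> part W q"
proof -
  obtain P where v: "v = word_eval V J P"
    by (rule word_eval_cases)
  define A where "A r = {w \<in> Poly_Mapping.keys P. word_parity p w = r}" for r
  define u where "u r = (\<Sum>w\<in>A r. smul V (Poly_Mapping.lookup P w) (mode_word V J w (vac V)))" for r
  have fin: "finite (A r)" for r
    by (simp add: A_def)
  have "Poly_Mapping.keys P = A q \<union> A (\<not> q)" "A q \<inter> A (\<not> q) = {}"
    by (auto simp: A_def)
  then have vu: "v = u q + u (\<not> q)"
    by (simp add: v word_eval_def u_def sum.union_disjoint fin)
  have u_part: "u r \<in> part V r" for r
    unfolding u_def using V.mode_word_part[where g = J, OF V.J_part] by (auto simp: A_def)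
  \<comment> \<open>The component of the wrong parity equals \<open>v - u q\<close>, so it lies in
    both parts and is 0.\<close>
  have "u (\<not> q) \<in> part V q"
    using V.part_closed(5)[OF assms u_part[of q]] by (simp add: vu)
  then have "u (\<not> q) \<in> part V False \<inter> part V True"
    using u_part[of "\<not> q"] by (cases q) auto
  then have "v = u q"
    using vu V.part_inter by simp
  moreover have "realization (u q) \<in> part W q"
    unfolding u_def realization.sum
    using W.mode_word_part[where g = K, OF K_part]
    by (auto simp: A_def realization.scale realization_mode_word)
  ultimately show ?thesis by simp
qed

lemma realization_hom: "vsa_hom V W realization"
  unfolding vsa_hom_def
  using realization.linear_axioms realization_part realization_vac realization_product by blast

end

section \<open>The free fields in the tensor product\<close>

lemma (in vertex_superalgebra) basis_family_nonzero:
  assumes "basis_family (smul V) I f" "i \<in> I"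
  shows "f i \<noteq> 0"
  using assms vs.dependent_zero[of "f ` I"] unfolding basis_family_def by force

text \<open>The empty monomial makes \<open>\<Omega> j\<close> itself a basis vector.\<close>

lemma (in vertex_superalgebra) freely_generated_over_nonzero:
  assumes "freely_generated_over V odd_gen g \<Omega>"
  shows "\<Omega> j \<noteq> 0"
proof -
  have "([], j) \<in> {w. pbw_ordered odd_gen w} \<times> UNIV"
    by (simp add: pbw_ordered_def)
  from basis_family_nonzero[OF assms[unfolded freely_generated_over_def] this]
  show ?thesis
    by (simp add: pbw_monomial_def)
qed

lemma (in vertex_superalgebra) nonzero_in_basis:
  assumes "v \<noteq> 0"
  obtains X where "v \<in> X" "basis_family (smul V) X (\<lambda>x. x)"
proof
  have "vs.independent {v}"
    using assms by simp
  then show "v \<in> vs.extend_basis {v}" "basis_family (smul V) (vs.extend_basis {v}) (\<lambda>x. x)"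
    using vs.extend_basis_superset[of "{v}"] vs.independent_extend_basis[of "{v}"]
      vs.span_extend_basis[of "{v}"]
    by (auto simp: basis_family_def)
qed

section \<open>Products with one factor of a tensor product\<close>

context vsa_tensor
begin

lemma tensor_linear [simp]:
  "t (a + a') b = t a b + t a' b" "t (smul A z a) b = smul W z (t a b)" "t 0 b = 0" "t (- a) b = - t a b" "t (a - a') b = t a b - t a' b"
  "t a (b + b') = t a b + t a b'" "t a (smul B z b) = smul W z (t a b)" "t a 0 = 0" "t a (- b) = - t a b" "t a (b - b') = t a b - t a b'"
proof -
  interpret l: Vector_Spaces.linear "smul A" "smul W" "\<lambda>a. t a b"
    by (rule bilinear_left)
  show "t (a + a') b = t a b + t a' b" "t (smul A z a) b = smul W z (t a b)" "t 0 b = 0" "t (- a) b = - t a b" "t (a - a') b = t a b - t a' b"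
    by (simp_all only: l.add l.scale l.zero l.neg l.diff)
next
  interpret l: Vector_Spaces.linear "smul B" "smul W" "\<lambda>b. t a b"
    by (rule bilinear_right)
  show "t a (b + b') = t a b + t a b'" "t a (smul B z b) = smul W z (t a b)" "t a 0 = 0" "t a (- b) = - t a b" "t a (b - b') = t a b - t a b'"
    by (simp_all only: l.add l.scale l.zero l.neg l.diff)
qed

lemma product_left_factor [simp]:
  "nprod W (t a (vac B)) n (t a' b) = t (nprod A a n a') b"
proof (induction a' rule: A.part_induct)
  case (part q a')
  have "nprod W (t a (vac B)) n (t a' b) = Sum_any (\<lambda>j::int. smul W (super_sign False q)
      (t (nprod A a j a') (nprod B (vac B) (n - j - 1) b)))"
    by (rule product[OF B.vac_even part])
  \<comment> \<open>The only non-zero mode of the vacuum is \<open>-1\<close>, which forces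
    \<open>j = n\<close>.\<close>
  also have "\<dots> = smul W (super_sign False q) (t (nprod A a n a') (nprod B (vac B) (n - n - 1) b))"
    by (rule Sum_any_eq_single) simp
  finally show ?case by (simp add: super_sign_def)
qed simp

lemma product_right_factor:
  assumes "b \<in> part B p" "a \<in> part A q"
  shows "nprod W (t (vac A) b) n (t a b') = smul W (super_sign p q) (t a (nprod B b n b'))"
proof -
  have "nprod W (t (vac A) b) n (t a b') = Sum_any (\<lambda>j::int. smul W (super_sign p q)
      (t (nprod A (vac A) j a) (nprod B b (n - j - 1) b')))"
    by (rule product[OF assms])
  also have "\<dots> = smul W (super_sign p q) (t (nprod A (vac A) (-1) a) (nprod B b (n - (-1) - 1) b'))"
    by (rule Sum_any_eq_single) simp
  finally show ?thesis by simp
qed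

lemma product_even_right_factor:
  assumes "b \<in> part B False"
  shows "nprod W (t (vac A) b) n (t a b') = t a (nprod B b n b')"
  by (induction a rule: A.part_induct) (simp_all add: product_right_factor[OF assms] super_sign_def)

text \<open>Extend \<open>a\<close> and \<open>b\<close> to bases; then their tensor belongs to a
  basis.\<close>

lemma tensor_nonzero:
  assumes "a \<noteq> 0" "b \<noteq> 0"
  shows "t a b \<noteq> 0"
proof -
  obtain X where X: "a \<in> X" "basis_family (smul A) X (\<lambda>x. x)"
    using A.nonzero_in_basis[OF assms(1)] by blast
  obtain Y where Y: "b \<in> Y" "basis_family (smul B) Y (\<lambda>y. y)"
    using B.nonzero_in_basis[OF assms(2)] by blast
  show ?thesis
    using W.basis_family_nonzero[OF basis[OF X(2) Y(2)], of "(a, b)"] X(1) Y(1) by simp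
qed

lemma tensor_induct [consumes 0, case_names scale add tensor]:
  assumes "\<And>z w. Q w \<Longrightarrow> Q (smul W z w)" "\<And>v w. Q v \<Longrightarrow> Q w \<Longrightarrow> Q (v + w)"
    and "\<And>a b. Q (t a b)"
  shows "Q w"
proof -
  define X Y where "X = A.vs.extend_basis {}" and "Y = B.vs.extend_basis {}"
  have "basis_family (smul A) X (\<lambda>x. x)" "basis_family (smul B) Y (\<lambda>y. y)"
    unfolding X_def Y_def basis_family_def
    by (simp_all add: A.vs.independent_extend_basis A.vs.span_extend_basis A.vs.independent_empty
        B.vs.independent_extend_basis B.vs.span_extend_basis B.vs.independent_empty)
  from basis[OF this] have "w \<in> W.vs.span ((\<lambda>(x, y). t x y) ` (X \<times> Y))"
    by (simp add: basis_family_def)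
  then show ?thesis
  proof (induction rule: W.vs.span_induct_alt)
    case base
    show ?case using assms(3)[of 0 0] by simp
  next
    case (step z x y)
    then show ?case using assms by auto
  qed
qed

end

section \<open>Non-negative products in the three factors\<close>

context ns_cri
begin

lemma vac_nonzero: "vac V \<noteq> 0"
  by (rule freely_generated_over_nonzero[OF free[unfolded freely_generated_def]])

text \<open>Apply the anticommutator with \<open>n = -1\<close> to the vacuum: one term dies, the
  other is the product sought. For \<open>j = 2\<close> the central factor \<open>j (j - 1)\<close>
  is 2.\<close>

lemma G_G: "j \<ge> 0 \<Longrightarrow> nprod V G j G =
    (if j = 0 then smul V 2 T else if j = 2 then smul V (-2) (vac V) else 0)"
  using G_anticommutator[of j "-1" "vac V"] by (auto simp: eq_neg_iff_add_eq_0 split: if_splits)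

lemma T_annihilates: "j \<ge> 0 \<Longrightarrow> nprod V T j v = 0"
proof -
  assume j: "j \<ge> 0"
  have "nprod V T j (nprod V v (-1) (vac V)) = nprod V v (-1) (nprod V T j (vac V))"
    using T_central unfolding central_in_def by blast
  then show ?thesis using j by simp
qed

end

context fermion
begin

lemma vac_nonzero: "vac V \<noteq> 0"
  by (rule freely_generated_over_nonzero[OF free[unfolded freely_generated_def]])

lemma Psi_Psi: "j \<ge> 0 \<Longrightarrow> nprod V Psi j Psi = (if j = 0 then vac V else 0)"
  using Psi_anticommutator[of j "-1" "vac V"] by auto

end

context half_lattice
begin

lemma vac_nonzero: "vac V \<noteq> 0"
  using freely_generated_over_nonzero[OF fock, of 0] by (simp add: E_0)

lemma c_c: "j \<ge> 0 \<Longrightarrow> nprod V c j c = 0"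
  using comm_cc[of j "-1" "vac V"] by simp

lemma d_d: "j \<ge> 0 \<Longrightarrow> nprod V d j d = 0"
  using comm_dd[of j "-1" "vac V"] by simp

lemma c_d: "j \<ge> 0 \<Longrightarrow> nprod V c j d = (if j = 1 then smul V 2 (vac V) else 0)"
  using comm_cd[of j "-1" "vac V"] by (auto split: if_splits)

lemma d_c: "j \<ge> 0 \<Longrightarrow> nprod V d j c = (if j = 1 then smul V 2 (vac V) else 0)"
  using comm_cd[of "-1" j "vac V"] by (auto split: if_splits)

lemma exp_coeff_creation_0: "exp_coeff V (\<lambda>i v. smul V z (nprod V a (f i) v)) l 0 = 0"
proof (induction l rule: less_induct)
  case (less l)
  then show ?case by (cases l) simp_all
qed

text \<open>\<open>E s\<close> is killed by the modes \<open>c_n\<close> with \<open>n > 0\<close>,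
  so the annihilating exponential acts as the identity.\<close>

lemma exp_coeff_annihilation:
  "exp_coeff V (\<lambda>i v. smul V z (nprod V c (int i) v)) l (E s) = (if l = 0 then E s else 0)"
proof (induction l rule: less_induct)
  case (less l)
  show ?case
  proof (cases l)
    case (Suc m)
    have "smul V z (nprod V c (int (Suc i))
        (exp_coeff V (\<lambda>i v. smul V z (nprod V c (int i) v)) (m - i) (E s))) = 0" for i
      using less[of "m - i"] Suc by (simp add: c_E)
    then show ?thesis
      unfolding Suc exp_coeff.simps by (simp only: sum.neutral_const) simp
  qed simp
qed

text \<open>Take the empty monomial in \<open>vertex_operator\<close>; the annihilating exponential
  contributes only in degree 0, which leaves \<open>l = - n - 1\<close>.\<close>

lemma E_E:
  "nprod V (E r) n (E s) = (if n < 0 then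
     exp_coeff V (\<lambda>i v. smul V (of_int r / 2) (nprod V c (- int i) v)) (nat (- n - 1)) (E (r + s)) else 0)"
proof -
  let ?f = "\<lambda>l::nat. if int l + n + 1 \<ge> 0 then
      exp_coeff V (\<lambda>i v. smul V (of_int r / 2) (nprod V c (- int i) v)) l
        (exp_coeff V (\<lambda>i v. smul V (- of_int r / 2) (nprod V c (int i) v)) (nat (int l + n + 1)) (E (r + s)))
      else 0"
  have E: "nprod V (E r) n (E s) = Sum_any ?f"
    using vertex_operator[of r n "[]" s] unfolding pbw_monomial_def list.map mode_word_simps .
  have f: "?f l = 0" if "int l \<noteq> - n - 1" for l
    using that unfolding exp_coeff_annihilation by (simp add: exp_coeff_creation_0)
  show ?thesis
  proof (cases "n < 0")
    case True
    have "Sum_any ?f = ?f (nat (- n - 1))"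
      by (rule Sum_any_eq_single) (rule f, use True in auto)
    then show ?thesis
      using True unfolding E exp_coeff_annihilation by simp
  next
    case False
    then have "Sum_any ?f = 0"
      using f by (simp add: Sum_any.expand_set)
    then show ?thesis
      using False by (simp add: E)
  qed
qed

text \<open>The right-hand sides are the elementary Schur polynomials of degree 0, 1 and 2 in the
  modes \<open>(r / 2) c_(-i)\<close>.\<close>

lemma E_E_simps:
  "n \<ge> 0 \<Longrightarrow> nprod V (E r) n (E s) = 0"
  "nprod V (E r) (-1) (E s) = E (r + s)"
  "nprod V (E r) (-2) (E s) = smul V (of_int r / 2) (nprod V c (-1) (E (r + s)))"
  "nprod V (E r) (-3) (E s) = smul V (1 / 2) (smul V (of_int r / 2) (nprod V c (-2) (E (r + s)))
     + smul V ((of_int r / 2)\<^sup>2) (nprod V c (-1) (nprod V c (-1) (E (r + s)))))"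
  unfolding E_E by (simp_all add: numeral_2_eq_2 eval_nat_numeral add.commute)

end

section \<open>Transfer to the triple tensor product\<close>

locale free_field_setting =
  C: ns_cri C G T + F: fermion F Psi + P: half_lattice P c d E
  + CF: vsa_tensor C F CF tCF + W: vsa_tensor CF P W t
  for C :: "'a::ab_group_add vsa" and G T
    and F :: "'b::ab_group_add vsa" and Psi
    and P :: "'p::ab_group_add vsa" and c d E
    and CF :: "'ab::ab_group_add vsa" and tCF
    and W :: "'w::ab_group_add vsa" and t
begin

definition \<nu> where "\<nu> = nu P (- 3 / 2) c d"

lemma \<nu>_eq: "\<nu> = smul P (1 / 2) d + smul P (3 / 8) c"
  by (simp add: \<nu>_def nu_def)

lemma P_even [simp]: "p \<in> part P False"
  by (simp add: P.purely_even)

text \<open>No sign arises because \<open>Psi\<close> only passes the even vacuum of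
  \<open>C\<close>.\<close>

lemma Psi_even: "nprod CF (tCF (vac C) Psi) n (tCF (vac C) b) = tCF (vac C) (nprod F Psi n b)"
  using CF.product_right_factor[OF F.Psi_odd C.vac_even] by (simp add: super_sign_def)

lemma tensor_free_fields:
  "free_fields W (t (tCF G (vac F)) (vac P)) (t (tCF T (vac F)) (vac P)) (t (tCF (vac C) Psi) (vac P))
     (t (vac CF) c) (t (vac CF) \<nu>) (\<lambda>r. t (vac CF) (E r))"
proof
  fix v and j :: int
  assume j: "0 \<le> j"
  show "nprod W (t (tCF T (vac F)) (vac P)) j v = 0"
  \<comment> \<open>This axiom concerns an arbitrary vector of \<open>W\<close>, so it is checked on
    simple tensors, where the mode acts through \<open>T\<close> alone.\<close>
  proof (induction v rule: W.tensor_induct)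
    case (tensor u p)
    have "nprod CF (tCF T (vac F)) j u = 0"
      by (induction u rule: CF.tensor_induct) (simp_all add: C.T_annihilates j)
    then show ?case by simp
  qed simp_all
next
  have part: "t (tCF a b) q \<in> part W (r \<noteq> s)" if "a \<in> part C r" "b \<in> part F s" for a b q r s
    using W.tensor_part[OF CF.tensor_part[OF that] P_even, of q] by simp
  show "t (tCF G (vac F)) (vac P) \<in> part W True" "t (tCF T (vac F)) (vac P) \<in> part W False"
    "t (tCF (vac C) Psi) (vac P) \<in> part W True"
    using part[OF C.G_odd F.vac_even] part[OF C.T_even F.vac_even] part[OF C.vac_even F.Psi_odd]
    by simp_all
  show "t (vac CF) c \<in> part W False" "t (vac CF) \<nu> \<in> part W False"
    "t (vac CF) (E r) \<in> part W False" for r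
    using part[OF C.vac_even F.vac_even] by (simp_all add: CF.tensor_vac)
qed (simp_all add: W.product_even_right_factor C.G_G Psi_even F.Psi_Psi CF.tensor_vac W.tensor_vac
    P.c_c P.c_d P.d_c P.d_d P.c_E P.d_E \<nu>_eq P.E_E_simps P.E_0 W.W.vs.scale_left_distrib[symmetric])

sublocale ff: free_fields W "t (tCF G (vac F)) (vac P)" "t (tCF T (vac F)) (vac P)"
    "t (tCF (vac C) Psi) (vac P)" "t (vac CF) c" "t (vac CF) \<nu>" "\<lambda>r. t (vac CF) (E r)"
  by (rule tensor_free_fields)

lemma Psi_vac: "nprod CF (tCF (vac C) Psi) n (vac CF) = tCF (vac C) (nprod F Psi n (vac F))"
  using Psi_even[of n "vac F"] by (simp add: CF.tensor_vac)

abbreviation image_f :: 'w where "image_f \<equiv> t (smul CF (1 / 2) (omega12 C F CF tCF G T Psi)) (E (-2))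
      - t (vac CF) (nprod P \<nu> (-1) (nprod P \<nu> (-1) (E (-2))))
      - t (vac CF) (smul P (- 1 / 2) (nprod P \<nu> (-2) (E (-2))))"

abbreviation image_h :: 'w where "image_h \<equiv> t (vac CF) (smul P 2 (nprod P (mu P (- 3 / 2) c d) (-1) (vac P)))"

abbreviation image_x :: 'w where "image_x \<equiv>
  smul W (complex_of_real (sqrt 2)) (t (tCF (vac C) (nprod F Psi (-1) (vac F))) (E 1))"

abbreviation image_y :: 'w where "image_y \<equiv> smul W (complex_of_real (sqrt 2))
       (smul W (- \<i> / 2) (t (tCF (nprod C G (-1) (vac C)) (vac F)) (E (-1)))
        + t (tCF (vac C) (nprod F Psi (-1) (vac F))) (nprod P \<nu> (-1) (E (-1)))
        + smul W (- 1)
            (t (tCF (vac C) (nprod F Psi (-2) (vac F))) (E (-1))))"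

lemma image_h_eq: "image_h = ff.h0"
  unfolding ff.h0_def
  by (rule W.W.eq_by_functionals) (simp add: CF.tensor_vac Psi_vac Psi_even W.product_even_right_factor P.E_0 \<nu>_eq mu_def)

lemma image_x_eq: "image_x = smul W (complex_of_real (sqrt 2)) ff.x0"
  unfolding ff.x0_def
  by (rule W.W.eq_by_functionals) (simp add: CF.tensor_vac Psi_vac Psi_even W.product_even_right_factor P.E_0)

lemma image_y_eq: "image_y = smul W (complex_of_real (sqrt 2)) ff.y0"
  unfolding ff.y0_def ff.w0_def
  by (rule W.W.eq_by_functionals) (simp add: CF.tensor_vac Psi_vac Psi_even W.product_even_right_factor)

lemma image_f_eq: "image_f = ff.f0"
  unfolding ff.f0_def omega12_def omega_F_def
  by (rule W.W.eq_by_functionals) (simp add: CF.tensor_vac Psi_vac Psi_even W.product_even_right_factor)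

text \<open>The Sugawara vector of \<open>V\<close> is a preimage, and regularity against every
  vector makes the image commute with all modes in \<open>W\<close>.\<close>

lemma \<tau>_in_range_central:
  assumes hom: "vsa_hom V W \<Phi>" and J: "\<And>a. \<Phi> (J a) = ff.osp_field a"
  shows "central_in W (range \<Phi>) (t (tCF T (vac F)) (vac P))"
proof -
  let ?\<tau> = "t (tCF T (vac F)) (vac P)"
  interpret \<Phi>: Vector_Spaces.linear "smul V" "smul W" \<Phi>
    using hom by (simp add: vsa_hom_def)
  have "\<Phi> (smul V 2 (nprod V (J osp_e) (-1) (J osp_f)) - nprod V (J osp_x) (-1) (J osp_y)
      + smul V (1 / 2) (nprod V (J osp_h) (-1) (J osp_h)) - smul V (1 / 2) (nprod V (J osp_h) (-2) (vac V)))
    = ?\<tau>"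
    using hom ff.osp_field_sugawara
    by (simp add: \<Phi>.add \<Phi>.diff \<Phi>.scale vsa_hom_def J del: ff.osp_field.simps)
  then have "?\<tau> \<in> range \<Phi>"
    by (metis rangeI)
  then show ?thesis
    unfolding central_in_def
    using W.W.regular_imp_commute[OF ff.parity(2) ff.\<tau>_regular] by blast
qed

text \<open>This yields non-triviality in the strong sense that the image exceeds the multiples of
  the vacuum.\<close>

lemma osp_e_not_vacuum: "ff.osp_field osp_e \<notin> W.W.vs.span {vac W}"
proof
  assume "ff.osp_field osp_e \<in> W.W.vs.span {vac W}"
  then obtain z where z: "ff.osp_field osp_e = smul W z (vac W)"
    by (auto simp: W.W.vs.span_singleton)
  note ope = ff.osp_field_ope[unfolded W.W.current_ope_def]
  have "smul W 2 (ff.osp_field osp_e) = 0"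
    using ope[of osp_h osp_e] z by (simp add: UNIV_osp osp_vec_def del: ff.osp_field.simps)
  then have e: "ff.osp_field osp_e = 0"
    by (simp del: ff.osp_field.simps)
  have "ff.osp_field osp_h = 0"
    using ope[of osp_e osp_f] by (simp add: UNIV_osp osp_vec_def e del: ff.osp_field.simps)
  then have "vac W = 0"
    using ope[of osp_h osp_h] by (simp del: ff.osp_field.simps)
  moreover have "t (tCF (vac C) (vac F)) (vac P) \<noteq> 0"
    by (intro W.tensor_nonzero CF.tensor_nonzero C.vac_nonzero F.vac_nonzero P.vac_nonzero)
  ultimately show False
    by (simp add: CF.tensor_vac W.tensor_vac)
qed

end

theorem theorem11p4:
  fixes V :: "'v::ab_group_add vsa" and J :: "osp \<Rightarrow> 'v" and k :: complex
    and C :: "'a::ab_group_add vsa" and G T :: 'a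
    and F :: "'b::ab_group_add vsa" and Psi :: 'b
    and P :: "'p::ab_group_add vsa" and c d :: 'p and E :: "int \<Rightarrow> 'p"
    and CF :: "'ab::ab_group_add vsa" and tCF :: "'a \<Rightarrow> 'b \<Rightarrow> 'ab"
    and W :: "'w::ab_group_add vsa" and t :: "'ab \<Rightarrow> 'p \<Rightarrow> 'w"
  assumes k: "k = -3/2"
    and V: "universal_affine V osp_odd osp_bracket osp_form k J"
    and C: "ns_cri C G T"
    and F: "fermion F Psi"
    and P: "half_lattice P c d E"
    and CF: "vsa_tensor C F CF tCF"
    and W: "vsa_tensor CF P W t"
  shows "\<exists>\<Phi>. vsa_hom V W \<Phi> \<and>
    (\<exists>v. \<Phi> v \<notin> module.span (smul W) {vac W}) \<and>
    \<Phi> (J osp_e) = t (vac CF) (E 2) \<and>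
    \<Phi> (J osp_h) = t (vac CF) (smul P 2 (nprod P (mu P k c d) (-1) (vac P))) \<and>
    \<Phi> (J osp_f) =
      t (smul CF (k + 2) (omega12 C F CF tCF G T Psi)) (E (-2))
      - t (vac CF) (nprod P (nu P k c d) (-1) (nprod P (nu P k c d) (-1) (E (-2))))
      - t (vac CF) (smul P (k + 1) (nprod P (nu P k c d) (-2) (E (-2)))) \<and>
    \<Phi> (J osp_x) =
      smul W (complex_of_real (sqrt 2)) (t (tCF (vac C) (nprod F Psi (-1) (vac F))) (E 1)) \<and>
    \<Phi> (J osp_y) =
      smul W (complex_of_real (sqrt 2))
       (smul W (- \<i> / 2) (t (tCF (nprod C G (-1) (vac C)) (vac F)) (E (-1)))
        + t (tCF (vac C) (nprod F Psi (-1) (vac F))) (nprod P (nu P k c d) (-1) (E (-1)))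
        + smul W ((2 * k + 1) / 2)
            (t (tCF (vac C) (nprod F Psi (-2) (vac F))) (E (-1)))) \<and>
    T = smul C (1 / 2) (nprod C G 0 (nprod C G (-1) (vac C))) \<and>
    central_in W (range \<Phi>) (t (tCF T (vac F)) (vac P))"
proof -
  interpret free_field_setting C G T F Psi P c d E CF tCF W t
    using C F P CF W by (simp add: free_field_setting_def)
  interpret R: current_realization V osp_odd osp_bracket osp_form "- 3 / 2" J W ff.osp_field
    using V W.W.vertex_superalgebra_axioms ff.osp_field_part ff.osp_field_ope
    by (simp add: k current_realization_def current_realization_axioms_def)
  have k': "k + 2 = 1 / 2" "k + 1 = - 1 / 2" "(2 * k + 1) / 2 = - 1"
    by (simp_all add: k)
  have nu: "nu P k c d = \<nu>" and mu: "mu P k c d = mu P (- 3 / 2) c d"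
    by (simp_all add: k \<nu>_def)
  \<comment> \<open>In the indexing of \<open>nprod\<close>, \<open>G(-1/2)\<close> is mode 0 and
    \<open>G(-3/2)\<close> is mode -1, so this is \<open>G_0 G = 2 T\<close>.\<close>
  have T: "T = smul C (1 / 2) (nprod C G 0 (nprod C G (-1) (vac C)))"
    by (simp add: C.G_G)
  have "\<exists>v. R.realization v \<notin> W.W.vs.span {vac W}"
    using osp_e_not_vacuum R.realization_generator by metis
  moreover note R.realization_hom T \<tau>_in_range_central[OF R.realization_hom R.realization_generator]
  moreover note R.realization_generator[of osp_e, unfolded ff.osp_field.simps]
    R.realization_generator[of osp_h, unfolded ff.osp_field.simps]
    R.realization_generator[of osp_f, unfolded ff.osp_field.simps]
    R.realization_generator[of osp_x, unfolded ff.osp_field.simps]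
    R.realization_generator[of osp_y, unfolded ff.osp_field.simps]
  ultimately show ?thesis
    unfolding k' nu mu image_h_eq image_f_eq image_x_eq image_y_eq
    by (intro exI[of _ R.realization] conjI) assumption+
qed

end
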